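(* Let $G$ and $H$ be nontrivial connected graphs such that at least one of $G$ or $H$ has no isolatable vertices. The direct product $G \times H$ is well-dominated if and only if (up to isomorphism) $G=H=K_3$, or at least one of the factors $G,H$ is $K_2$ and the other factor is a $4$-cycle or the corona of a connected graph.
   Context: All graphs are finite and simple. A graph is nontrivial if it has at least $2$ vertices. For $S\subseteq V(G)$, $N[S]$ denotes the closed neighborhood of $S$ (all vertices in $S$ or adjacent to a vertex of $S$). A vertex $x$ of $G$ is isolatable if there is an independent set $I$ (possibly empty) in $G$ such that $x$ is an isolated vertex in $G-N[I]$. A set $D\subseteq V(G)$ is a dominating set if $N[D]=V(G)$. A graph is well-dominated if all of its minimal (with respect to inclusion) dominating sets have the same cardinality. The direct product $G\times H$ has vertex set $V(G)\times V(H)$, and $(g_1,h_1)$, $(g_2,h_2)$ are adjacent iff $g_1g_2\in E(G)$ and $h_1h_2\in E(H)$. The corona $F\circ K_1$ of a graph $F$ is formed from $F$ by adding, for each vertex of $F$, a single new vertex of degree $1$ adjacent to it. $K_n$ is the complete graph on $n$ vertices. *)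

theory Defs
  imports "Graph_Theory.Graph_Theory"
begin

text \<open>
  A finite simple graph is a \<^locale>\<open>pair_graph\<close>: a finite loop-free symmetric set of pairs.
  The predicates below are stated for general digraphs but are only meaningful for
  symmetric ones, where \<open>u \<rightarrow>\<^bsub>G\<^esub> v\<close> is adjacency.
\<close>

definition closed_nbhd :: "('a, 'b) pre_digraph \<Rightarrow> 'a set \<Rightarrow> 'a set" where
  "closed_nbhd G S = {v \<in> verts G. v \<in> S \<or> (\<exists>u \<in> S. u \<rightarrow>\<^bsub>G\<^esub> v)}"

definition independent_set :: "('a, 'b) pre_digraph \<Rightarrow> 'a set \<Rightarrow> bool" where
  "independent_set G I \<longleftrightarrow> I \<subseteq> verts G \<and> (\<forall>u \<in> I. \<forall>v \<in> I. \<not> u \<rightarrow>\<^bsub>G\<^esub> v)"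

definition isolated_vertex :: "('a, 'b) pre_digraph \<Rightarrow> 'a \<Rightarrow> bool" where
  "isolated_vertex G x \<longleftrightarrow> x \<in> verts G \<and> \<not> (\<exists>y. x \<rightarrow>\<^bsub>G\<^esub> y)"

definition isolatable :: "('a, 'b) pre_digraph \<Rightarrow> 'a \<Rightarrow> bool" where
  "isolatable G x \<longleftrightarrow>
    (\<exists>I. independent_set G I \<and> isolated_vertex (G \<restriction> (verts G - closed_nbhd G I)) x)"

definition dominating_set :: "('a, 'b) pre_digraph \<Rightarrow> 'a set \<Rightarrow> bool" where
  "dominating_set G D \<longleftrightarrow> D \<subseteq> verts G \<and> closed_nbhd G D = verts G"

definition minimal_dominating_set :: "('a, 'b) pre_digraph \<Rightarrow> 'a set \<Rightarrow> bool" where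
  "minimal_dominating_set G D \<longleftrightarrow>
    dominating_set G D \<and> (\<forall>D'. D' \<subset> D \<longrightarrow> \<not> dominating_set G D')"

definition well_dominated :: "('a, 'b) pre_digraph \<Rightarrow> bool" where
  "well_dominated G \<longleftrightarrow>
    (\<forall>D D'. minimal_dominating_set G D \<longrightarrow> minimal_dominating_set G D' \<longrightarrow> card D = card D')"

definition direct_product ::
    "'a pair_pre_digraph \<Rightarrow> 'b pair_pre_digraph \<Rightarrow> ('a \<times> 'b) pair_pre_digraph" where
  "direct_product G H = \<lparr>
    pverts = pverts G \<times> pverts H,
    parcs = {((g1, h1), (g2, h2)) | g1 h1 g2 h2. (g1, g2) \<in> parcs G \<and> (h1, h2) \<in> parcs H}\<rparr>"

text \<open>\<open>Inl u\<close> is the original vertex \<open>u\<close>, and \<open>Inr u\<close> is the new leaf attached to it.\<close>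

definition corona_K1 :: "'a pair_pre_digraph \<Rightarrow> ('a + 'a) pair_pre_digraph" where
  "corona_K1 F = \<lparr>
    pverts = Inl ` pverts F \<union> Inr ` pverts F,
    parcs = {(Inl u, Inl v) | u v. (u, v) \<in> parcs F}
      \<union> {(Inl u, Inr u) | u. u \<in> pverts F} \<union> {(Inr u, Inl u) | u. u \<in> pverts F}\<rparr>"

text \<open>
  Taking \<open>F\<close> on the vertex type of \<open>G\<close> loses no generality: if \<open>G\<close> is isomorphic to a corona
  of \<open>F\<close>, then \<open>G\<close> contains a copy of \<open>F\<close>. Note that \<^const>\<open>connected\<close> excludes the null graph.
\<close>

definition corona_of_connected_graph :: "'a pair_pre_digraph \<Rightarrow> bool" where
  "corona_of_connected_graph G \<longleftrightarrow>
    (\<exists>F :: 'a pair_pre_digraph. pair_graph F \<and> connected (with_proj F) \<and>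
      digraph_iso (with_proj G) (with_proj (corona_K1 F)))"

text \<open>The cycle \<open>C\<^sub>n\<close>, for \<open>n \<ge> 3\<close>.\<close>

definition cycle_graph :: "nat \<Rightarrow> nat pair_pre_digraph" where
  "cycle_graph n = \<lparr>
    pverts = {..<n},
    parcs = {(i, j). i < n \<and> j < n \<and> (j = Suc i mod n \<or> i = Suc j mod n)}\<rparr>"

lemma pair_graph_direct_product:
  assumes "pair_graph G" "pair_graph H"
  shows "pair_graph (direct_product G H)"
proof -
  interpret G: pair_graph G by fact
  interpret H: pair_graph H by fact
  have sub: "parcs (direct_product G H) \<subseteq> (pverts G \<times> pverts H) \<times> (pverts G \<times> pverts H)"
    by (auto simp: direct_product_def dest: G.in_arcsD1 G.in_arcsD2 H.in_arcsD1 H.in_arcsD2)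
  then have "finite (parcs (direct_product G H))"
    by (rule finite_subset) (simp add: G.pair_finite_verts H.pair_finite_verts)
  then show ?thesis
    by unfold_locales
      (auto simp: direct_product_def symmetric_def G.pair_finite_verts H.pair_finite_verts
        intro!: symI
        dest: G.in_arcsD1 G.in_arcsD2 H.in_arcsD1 H.in_arcsD2
          G.arcs_symmetric H.arcs_symmetric G.no_loops')
qed

lemma pair_graph_corona_K1:
  assumes "pair_graph F"
  shows "pair_graph (corona_K1 F)"
proof -
  interpret F: pair_graph F by fact
  have sub: "parcs (corona_K1 F) \<subseteq> pverts (corona_K1 F) \<times> pverts (corona_K1 F)"
    by (auto simp: corona_K1_def dest: F.in_arcsD1 F.in_arcsD2)
  have fin: "finite (pverts (corona_K1 F))"
    by (simp add: corona_K1_def F.pair_finite_verts)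
  then have "finite (parcs (corona_K1 F))"
    using sub by (meson finite_SigmaI finite_subset)
  then show ?thesis
    using fin
    by unfold_locales
      (auto simp: corona_K1_def symmetric_def intro!: symI
        dest: F.in_arcsD1 F.in_arcsD2 F.arcs_symmetric F.no_loops')
qed

lemma cycle_graph_4:
  "pverts (cycle_graph 4) = {0, 1, 2, 3}"
  "parcs (cycle_graph 4) = {(0,1), (1,0), (1,2), (2,1), (2,3), (3,2), (3,0), (0,3)}"
proof -
  have lt: "i < 4 \<longleftrightarrow> i = 0 \<or> i = 1 \<or> i = 2 \<or> i = 3" for i :: nat by auto
  show "pverts (cycle_graph 4) = {0, 1, 2, 3}"
    by (auto simp: cycle_graph_def lt)
  show "parcs (cycle_graph 4) = {(0,1), (1,0), (1,2), (2,1), (2,3), (3,2), (3,0), (0,3)}"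
    by (auto simp: cycle_graph_def lt)
qed

end

theory Submission
  imports Defs
begin

text \<open>
  In a well-dominated graph no dominating set is smaller than an independent dominating set, and
  this weaker property survives deleting the closed neighbourhood \<open>N[I]\<close> of an independent set.

  Suppose \<open>H\<close> has no isolatable vertex and \<open>J\<close> is a maximal independent set of \<open>H\<close> with one
  vertex removed. Then \<open>H - N[J]\<close> is a clique \<open>C\<close> with \<open>r \<ge> 2\<close> vertices, and \<open>G \<times> C\<close> inherits the
  property. If \<open>r \<ge> 3\<close>, then for every maximal independent set \<open>I\<close> of \<open>G\<close> the set
  \<open>I \<times> {c\<^sub>1, c\<^sub>2}\<close> together with a copy in layer \<open>c\<^sub>1\<close> of one neighbour of each \<open>i \<in> I\<close> dominates.
  Comparing it with \<open>I \<times> C\<close> gives \<open>r = 3\<close> and shows that no two vertices of \<open>I\<close> have a common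
  neighbour, so that \<open>G = K\<^sub>3\<close>, and by the same argument \<open>H = K\<^sub>3\<close>.

  If \<open>r = 2\<close>, then \<open>K\<^sub>2 \<times> G\<close> has the property. Trading vertices of one layer for vertices of the
  other shows that every vertex \<open>y\<close> of degree \<open>d \<ge> 2\<close> either has \<open>d - 1\<close> neighbours that carry
  leaves or has degree 2 and a twin; hence \<open>G\<close> is a corona or a 4-cycle. If moreover \<open>H\<close> is not
  \<open>K\<^sub>2\<close>, then \<open>G\<close> is no 4-cycle because \<open>{a, b} \<times> (V(H) - {v})\<close> would dominate, and if \<open>G\<close> is a
  corona then \<open>K\<^sub>2 \<times> H\<close> has the property as well, which makes \<open>H\<close> a corona or a 4-cycle and
  gives it an isolatable vertex.
\<close>

section \<open>Tight domination and direct products\<close>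

definition indep_rel :: "'a rel \<Rightarrow> 'a set \<Rightarrow> bool" where
  "indep_rel E I \<longleftrightarrow> (\<forall>u\<in>I. \<forall>v\<in>I. (u, v) \<notin> E)"

definition dom_rel :: "'a rel \<Rightarrow> 'a set \<Rightarrow> 'a set \<Rightarrow> bool" where
  "dom_rel E V D \<longleftrightarrow> D \<subseteq> V \<and> (\<forall>v\<in>V. v \<in> D \<or> (\<exists>u\<in>D. (u, v) \<in> E))"

definition tight_rel :: "'a rel \<Rightarrow> 'a set \<Rightarrow> bool" where
  "tight_rel E V \<longleftrightarrow>
    (\<forall>I D. indep_rel E I \<longrightarrow> dom_rel E V I \<longrightarrow> dom_rel E V D \<longrightarrow> card I \<le> card D)"

definition prod_rel :: "'a rel \<Rightarrow> 'b rel \<Rightarrow> ('a \<times> 'b) rel" where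
  "prod_rel E F = {((g, h), (g', h')). (g, g') \<in> E \<and> (h, h') \<in> F}"

lemma in_prod_rel [simp]: "((g, h), (g', h')) \<in> prod_rel E F \<longleftrightarrow> (g, g') \<in> E \<and> (h, h') \<in> F"
  by (simp add: prod_rel_def)

lemma sym_prod_rel: "sym E \<Longrightarrow> sym F \<Longrightarrow> sym (prod_rel E F)"
  by (auto simp: sym_def)

lemma tight_relD:
  assumes "tight_rel E V" "indep_rel E I" "dom_rel E V I" "dom_rel E V D"
  shows "card I \<le> card D"
  using assms unfolding tight_rel_def by blast

lemma tight_rel_card_eq:
  assumes "tight_rel E V" "indep_rel E I" "dom_rel E V I" "indep_rel E J" "dom_rel E V J"
  shows "card I = card J"
  using assms by (meson tight_relD le_antisym)

lemma maximal_indep_extension: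
  assumes "finite V" "sym E" "irrefl E" "J \<subseteq> V" "indep_rel E J"
  obtains I where "J \<subseteq> I" "indep_rel E I" "dom_rel E V I"
proof -
  let ?P = "{I. J \<subseteq> I \<and> I \<subseteq> V \<and> indep_rel E I}"
  have "finite ?P" "J \<in> ?P"
    using assms by (auto intro: finite_subset[of _ "Pow V"])
  then obtain I where I: "I \<in> ?P" and max: "\<And>K. K \<in> ?P \<Longrightarrow> I \<subseteq> K \<Longrightarrow> I = K"
    using finite_has_maximal2[of ?P J] by auto
  have "\<exists>u\<in>I. (u, v) \<in> E" if "v \<in> V" "v \<notin> I" for v
  proof (rule ccontr)
    assume "\<not> (\<exists>u\<in>I. (u, v) \<in> E)"
    then have "insert v I \<in> ?P"
      using I that assms(2,3) unfolding indep_rel_def by (auto dest: symD simp: irrefl_def)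
    then show False using max that by blast
  qed
  then have "dom_rel E V I" using I by (auto simp: dom_rel_def)
  then show thesis using I that by blast
qed

text \<open>Adding \<open>I\<close> to an independent dominating set and to a dominating set of the
  remainder yields such sets for \<open>V\<close>, and both cardinalities grow by
  \<open>card I\<close>.\<close>

lemma tight_rel_delete_closed_nbhd:
  assumes fin: "finite V" and "sym E" and tight: "tight_rel E V"
    and I: "I \<subseteq> V" "indep_rel E I"
  shows "tight_rel E (V - I - E `` I)"
  unfolding tight_rel_def
proof (intro allI impI)
  let ?V = "V - I - E `` I"
  fix J D
  assume J: "indep_rel E J" "dom_rel E ?V J" and D: "dom_rel E ?V D"
  have "indep_rel E (J \<union> I)"
    using I(2) J \<open>sym E\<close> unfolding indep_rel_def dom_rel_def by (blast dest: symD)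
  moreover have "dom_rel E V (J \<union> I)" "dom_rel E V (D \<union> I)"
    using I(1) J(2) D unfolding dom_rel_def by blast+
  ultimately have "card (J \<union> I) \<le> card (D \<union> I)"
    using tight tight_relD by blast
  moreover have "J \<subseteq> V - I" "D \<subseteq> V - I"
    using J(2) D by (auto simp: dom_rel_def)
  then have "finite I" "finite J" "finite D" "J \<inter> I = {}" "D \<inter> I = {}"
    using fin I(1) by (auto intro: finite_subset)
  ultimately show "card J \<le> card D"
    by (simp add: card_Un_disjoint)
qed

section \<open>Exchanging the factors and deleting neighbourhoods in one factor\<close>

lemma dom_rel_swap:
  assumes "dom_rel (prod_rel F E) (W \<times> V) X"
  shows "dom_rel (prod_rel E F) (V \<times> W) (prod.swap ` X)"
  unfolding dom_rel_def
proof (intro conjI ballI)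
  show "prod.swap ` X \<subseteq> V \<times> W" using assms by (auto simp: dom_rel_def)
  fix p assume "p \<in> V \<times> W"
  then obtain v w where p: "p = (v, w)" "(w, v) \<in> W \<times> V" by auto
  then have "(w, v) \<in> X \<or> (\<exists>q\<in>X. (q, (w, v)) \<in> prod_rel F E)"
    using assms unfolding dom_rel_def by blast
  then consider "(w, v) \<in> X" | h g where "(h, g) \<in> X" "((h, g), (w, v)) \<in> prod_rel F E"
    by (metis surj_pair)
  then show "p \<in> prod.swap ` X \<or> (\<exists>q\<in>prod.swap ` X. (q, p) \<in> prod_rel E F)"
  proof cases
    case 2
    then have "(g, h) \<in> prod.swap ` X" "((g, h), p) \<in> prod_rel E F" using p by force+
    then show ?thesis by blast
  qed (use p in force)
qed

lemma tight_rel_swap: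
  assumes "tight_rel (prod_rel E F) (V \<times> W)"
  shows "tight_rel (prod_rel F E) (W \<times> V)"
  unfolding tight_rel_def
proof (intro allI impI)
  fix I D
  assume I: "indep_rel (prod_rel F E) I" "dom_rel (prod_rel F E) (W \<times> V) I"
    and D: "dom_rel (prod_rel F E) (W \<times> V) D"
  have "indep_rel (prod_rel E F) (prod.swap ` I)"
    using I(1) by (force simp: indep_rel_def)
  then have "card (prod.swap ` I) \<le> card (prod.swap ` D)"
    using assms I(2) D dom_rel_swap tight_relD by blast
  then show "card I \<le> card D"
    by (simp add: card_image)
qed

text \<open>As every vertex of the first factor has a neighbour, the closed neighbourhood of the
  independent set \<open>V \<times> J\<close> is the product of \<open>V\<close> with the closed
  neighbourhood of \<open>J\<close>.\<close>

lemma tight_prod_delete_closed_nbhd: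
  assumes "finite V" "finite W" "sym E" "sym F"
    and nbr: "\<And>v. v \<in> V \<Longrightarrow> \<exists>u\<in>V. (u, v) \<in> E"
    and tight: "tight_rel (prod_rel E F) (V \<times> W)"
    and J: "J \<subseteq> W" "indep_rel F J"
  shows "tight_rel (prod_rel E F) (V \<times> (W - J - F `` J))"
proof -
  have "V \<times> W - V \<times> J - prod_rel E F `` (V \<times> J) = V \<times> (W - J - F `` J)"
    (is "?L = ?R")
  proof
    show "?L \<subseteq> ?R"
    proof
      fix p assume p: "p \<in> ?L"
      then obtain v w where vw: "p = (v, w)" "v \<in> V" "w \<in> W" "w \<notin> J" by auto
      obtain u where u: "u \<in> V" "(u, v) \<in> E" using nbr vw(2) by blast
      have "w \<notin> F `` J"
      proof
        assume "w \<in> F `` J"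
        then obtain j where "j \<in> J" "(j, w) \<in> F" by blast
        then have "p \<in> prod_rel E F `` (V \<times> J)"
          using u vw(1) by (intro ImageI[of "(u, j)"]) auto
        then show False using p by simp
      qed
      then show "p \<in> ?R" using vw by simp
    qed
  qed auto
  moreover have "indep_rel (prod_rel E F) (V \<times> J)"
    using J(2) by (auto simp: indep_rel_def)
  ultimately show ?thesis
    using tight_rel_delete_closed_nbhd[of "V \<times> W" "prod_rel E F" "V \<times> J"] assms
    by (simp add: sym_prod_rel Sigma_mono)
qed

text \<open>Remove from a maximal independent set all but one vertex \<open>z\<close>: the vertices that are no longer
  dominated are all adjacent to \<open>z\<close>.\<close>

lemma tight_prod_clique:
  assumes fin: "finite V" "finite W" and "V \<noteq> {}" "W \<noteq> {}"
    and sym: "sym E" "sym F" and irr: "irrefl F"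
    and nbr: "\<And>v. v \<in> V \<Longrightarrow> \<exists>u\<in>V. (u, v) \<in> E"
    and tight: "tight_rel (prod_rel E F) (V \<times> W)"
    and noiso: "\<And>J x. J \<subseteq> W \<Longrightarrow> indep_rel F J \<Longrightarrow> x \<in> W - J - F `` J
      \<Longrightarrow> \<exists>y\<in>W - J - F `` J. (x, y) \<in> F"
  shows "\<exists>C\<subseteq>W. card C \<ge> 2 \<and> (\<forall>c\<in>C. \<forall>c'\<in>C. (c, c') \<in> F \<longleftrightarrow> c \<noteq> c')
    \<and> tight_rel (prod_rel E F) (V \<times> C)"
proof -
  obtain z where z: "z \<in> W" using \<open>W \<noteq> {}\<close> by blast
  have "indep_rel F {z}" using irr by (simp add: indep_rel_def irrefl_def)
  then obtain K where K: "{z} \<subseteq> K" "indep_rel F K" "dom_rel F W K"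
    using maximal_indep_extension[of W F "{z}"] fin sym irr z by auto
  define J where "J = K - {z}"
  define C where "C = W - J - F `` J"
  have J: "J \<subseteq> W" "indep_rel F J"
    using K by (auto simp: J_def dom_rel_def indep_rel_def)
  have CW: "C \<subseteq> W" "finite C" using fin by (auto simp: C_def)
  have zC: "z \<in> C" using z K by (auto simp: C_def J_def indep_rel_def)
  have univ: "(z, c) \<in> F" if "c \<in> C" "c \<noteq> z" for c
    using that K unfolding C_def J_def dom_rel_def by blast
  have tight': "tight_rel (prod_rel E F) (V \<times> C)"
    unfolding C_def using tight_prod_delete_closed_nbhd[OF fin sym nbr tight J] by blast
  \<comment> \<open>An independent dominating set \<open>I\<close> of \<open>C\<close> gives one of
    the product with \<open>card V * card I\<close> vertices; by tightness this number does not
    depend on \<open>I\<close>.\<close>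
  have max: "indep_rel (prod_rel E F) (V \<times> I)" "dom_rel (prod_rel E F) (V \<times> C) (V \<times> I)"
    if "indep_rel F I" "dom_rel F C I" for I
  proof -
    show "indep_rel (prod_rel E F) (V \<times> I)"
      using that(1) by (auto simp: indep_rel_def)
    show "dom_rel (prod_rel E F) (V \<times> C) (V \<times> I)"
      unfolding dom_rel_def
    proof (intro conjI ballI)
      fix p assume "p \<in> V \<times> C"
      then obtain v c where p: "p = (v, c)" "v \<in> V" "c \<in> C" by blast
      obtain u where u: "u \<in> V" "(u, v) \<in> E" using nbr p(2) by blast
      show "p \<in> V \<times> I \<or> (\<exists>q\<in>V \<times> I. (q, p) \<in> prod_rel E F)"
        using that(2) p u unfolding dom_rel_def by fastforce
    qed (use that(2) in \<open>auto simp: dom_rel_def\<close>)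
  qed
  have "dom_rel F C {z}" using zC univ by (auto simp: dom_rel_def)
  note z_max = max[OF \<open>indep_rel F {z}\<close> this]
  \<comment> \<open>Two nonadjacent vertices would lie in a maximal independent set \<open>I\<close>
    of \<open>C\<close>, and \<open>V \<times> I\<close> would be larger than
    \<open>V \<times> {z}\<close>.\<close>
  have clique: "(c, c') \<in> F" if c: "c \<in> C" "c' \<in> C" "c \<noteq> c'" for c c'
  proof (rule ccontr)
    assume "(c, c') \<notin> F"
    then have "indep_rel F {c, c'}"
      using sym irr by (auto simp: indep_rel_def irrefl_def dest: symD)
    then obtain I where I: "{c, c'} \<subseteq> I" "indep_rel F I" "dom_rel F C I"
      using maximal_indep_extension[of C F "{c, c'}"] CW sym irr c by auto
    have "card (V \<times> I) = card (V \<times> {z})"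
      by (rule tight_rel_card_eq[OF tight' max[OF I(2,3)] z_max])
    then have "card I = 1"
      using fin(1) \<open>V \<noteq> {}\<close> by (simp add: card_cartesian_product)
    then show False using I(1) c(3) by (auto simp: card_1_singleton_iff)
  qed
  obtain y where "y \<in> C" "(z, y) \<in> F"
    using noiso[OF J, of z] zC by (auto simp: C_def)
  then have "{z, y} \<subseteq> C" "z \<noteq> y" using zC irr by (auto simp: irrefl_def)
  then have "card C \<ge> 2"
    using CW(2) card_mono[of C "{z, y}"] by simp
  moreover have "\<forall>c\<in>C. \<forall>c'\<in>C. (c, c') \<in> F \<longleftrightarrow> c \<noteq> c'"
    using clique irr unfolding irrefl_def by blast
  ultimately show ?thesis using CW(1) tight' by blast
qed

text \<open>For a maximal independent \<open>I\<close>, three dominating sets are compared: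
  \<open>I \<times> C\<close>, \<open>V \<times> {c1}\<close> and one with at most
  \<open>3 * card I\<close> vertices. The resulting equalities force every choice of neighbours to
  be injective on \<open>I\<close>, so any two neighbours of a vertex are adjacent.\<close>

lemma tight_prod_large_clique:
  fixes E :: "'a rel" and F :: "'b rel"
  assumes fin: "finite V" and "V \<noteq> {}" and sym: "sym E" and irr: "irrefl E" and sub: "E \<subseteq> V \<times> V"
    and nbr: "\<And>v. v \<in> V \<Longrightarrow> \<exists>u. (u, v) \<in> E"
    and conn: "\<And>S. S \<subseteq> V \<Longrightarrow> S \<noteq> {} \<Longrightarrow> E `` S \<subseteq> S \<Longrightarrow> S = V"
    and C: "card C \<ge> 3" and clique: "\<And>c c'. c \<in> C \<Longrightarrow> c' \<in> C \<Longrightarrow> (c, c') \<in> F \<longleftrightarrow> c \<noteq> c'"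
    and tight: "tight_rel (prod_rel E F) (V \<times> C)"
  shows "card C = 3" "card V = 3" "u \<in> V \<Longrightarrow> v \<in> V \<Longrightarrow> (u, v) \<in> E \<longleftrightarrow> u \<noteq> v"
proof -
  have finC: "finite C" using C card.infinite by fastforce
  obtain c1 where c1: "c1 \<in> C" using C by fastforce
  have "\<not> C \<subseteq> {c1}"
    using C card_mono[of "{c1}" C] by auto
  then obtain c2 where c2: "c2 \<in> C" "c2 \<noteq> c1" by blast
  have key: "card C = 3 \<and> inj_on a I \<and> card I * card C = card V"
    if I: "indep_rel E I" "dom_rel E V I" and a: "\<And>i. i \<in> I \<Longrightarrow> (a i, i) \<in> E" for I a
  proof -
    have finI: "finite I" "I \<subseteq> V" "I \<noteq> {}"
      using I(2) fin \<open>V \<noteq> {}\<close> finite_subset by (auto simp: dom_rel_def)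
    \<comment> \<open>Over \<open>I\<close>, layers \<open>c1\<close> and \<open>c2\<close> lie in
      \<open>D\<close> and all others are dominated by \<open>(a i, c1)\<close>. Outside
      \<open>I\<close>, one of \<open>(i, c1)\<close> and \<open>(i, c2)\<close> dominates,
      depending on the layer.\<close>
    define D where "D = I \<times> {c1, c2} \<union> a ` I \<times> {c1}"
    have "indep_rel (prod_rel E F) (I \<times> C)" "indep_rel (prod_rel E F) (V \<times> {c1})"
      using I(1) c1 clique by (auto simp: indep_rel_def)
    moreover have dI: "dom_rel (prod_rel E F) (V \<times> C) (I \<times> C)"
      unfolding dom_rel_def
    proof (intro conjI ballI)
      fix p assume "p \<in> V \<times> C"
      then obtain v c where p: "p = (v, c)" "v \<in> V" "c \<in> C" by blast
      obtain c' where c': "c' \<in> C" "c' \<noteq> c" using c1 c2 by metis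
      show "p \<in> I \<times> C \<or> (\<exists>q\<in>I \<times> C. (q, p) \<in> prod_rel E F)"
        using I(2) p c' clique unfolding dom_rel_def by fastforce
    qed (use finI in auto)
    moreover have "dom_rel (prod_rel E F) (V \<times> C) (V \<times> {c1})"
      unfolding dom_rel_def
    proof (intro conjI ballI)
      fix p assume "p \<in> V \<times> C"
      then obtain v c where p: "p = (v, c)" "v \<in> V" "c \<in> C" by blast
      obtain u where u: "u \<in> V" "(u, v) \<in> E" using nbr sub p(2) by blast
      show "p \<in> V \<times> {c1} \<or> (\<exists>q\<in>V \<times> {c1}. (q, p) \<in> prod_rel E F)"
        using p u c1 clique by (cases "c = c1") auto
    qed (use c1 in auto)
    moreover have "dom_rel (prod_rel E F) (V \<times> C) D"
      unfolding dom_rel_def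
    proof (intro conjI ballI)
      show "D \<subseteq> V \<times> C"
        using finI c1 c2 a sub by (auto simp: D_def)
      fix p assume "p \<in> V \<times> C"
      then obtain v c where p: "p = (v, c)" "v \<in> V" "c \<in> C" by blast
      show "p \<in> D \<or> (\<exists>q\<in>D. (q, p) \<in> prod_rel E F)"
      proof (cases "v \<in> I")
        case True
        then have "p \<in> D \<or> ((a v, c1), p) \<in> prod_rel E F"
          using p a c1 clique by (auto simp: D_def)
        then show ?thesis using True by (auto simp: D_def)
      next
        case False
        then obtain i where i: "i \<in> I" "(i, v) \<in> E" using I(2) p by (auto simp: dom_rel_def)
        then have "((i, c1), p) \<in> prod_rel E F \<or> ((i, c2), p) \<in> prod_rel E F"
          using p c1 c2 clique by auto
        then show ?thesis using i(1) by (auto simp: D_def)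
      qed
    qed
    ultimately have 1: "card (I \<times> C) = card (V \<times> {c1})" "card (I \<times> C) \<le> card D"
      using tight tight_rel_card_eq tight_relD by blast+
    have "a ` I \<inter> I = {}" using a I(1) by (auto simp: indep_rel_def)
    then have "card D = 2 * card I + card (a ` I)"
      unfolding D_def using finI c2 by (subst card_Un_disjoint) (auto simp: card_cartesian_product)
    then have 2: "card I * card C \<le> 2 * card I + card (a ` I)"
      using 1(2) by (simp add: card_cartesian_product)
    \<comment> \<open>The image of \<open>I\<close> under \<open>a\<close> has at most
      \<open>card I\<close> elements, so \<open>card C \<le> 3\<close>. Equality leaves no slack,
      and \<open>a\<close> is injective.\<close>
    have 3: "card (a ` I) \<le> card I" "card I > 0" using finI by (auto simp: card_image_le card_gt_0_iff)
    then have "card I * card C \<le> card I * 3" using 2 by linarith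
    then have "card C = 3" using 3(2) C by (meson le_antisym mult_le_cancel1)
    then have "card (a ` I) = card I" using 2 3 by simp
    then have "inj_on a I" using finI eq_card_imp_inj_on by blast
    then show ?thesis using \<open>card C = 3\<close> 1(1) by (simp add: card_cartesian_product)
  qed
  obtain b where b: "\<And>v. v \<in> V \<Longrightarrow> (b v, v) \<in> E" using nbr by metis
  \<comment> \<open>Sending both \<open>i\<close> and \<open>j\<close> to their common neighbour
    \<open>u\<close> would be a non-injective choice on a maximal independent set containing
    them.\<close>
  have trans: "(i, j) \<in> E" if u: "(u, i) \<in> E" "(u, j) \<in> E" "i \<noteq> j" for u i j
  proof (rule ccontr)
    assume "(i, j) \<notin> E"
    then have "indep_rel E {i, j}" "{i, j} \<subseteq> V"
      using sym irr sub u by (auto simp: indep_rel_def irrefl_def dest: symD)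
    then obtain I where I: "{i, j} \<subseteq> I" "indep_rel E I" "dom_rel E V I"
      using maximal_indep_extension[of V E "{i, j}"] fin sym irr by auto
    have "I \<subseteq> V" using I(3) by (simp add: dom_rel_def)
    then have "inj_on (b(i := u, j := u)) I"
      using key[OF I(2,3), of "b(i := u, j := u)"] b u by (simp add: subset_iff)
    from inj_onD[OF this, of i j] show False using I(1) u(3) by simp
  qed
  \<comment> \<open>By \<open>trans\<close> the closed neighbourhood of \<open>v\<close> is closed
    under adjacency.\<close>
  have uni: "insert v (E `` {v}) = V" if "v \<in> V" for v
    using that sub sym by (intro conn) (auto dest: symD intro: trans)
  then show "(u, v) \<in> E \<longleftrightarrow> u \<noteq> v" if "u \<in> V" "v \<in> V" for u v
    using that irr unfolding irrefl_def by blast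
  obtain v where v: "v \<in> V" using \<open>V \<noteq> {}\<close> by blast
  have "indep_rel E {v}" using irr by (simp add: indep_rel_def irrefl_def)
  moreover have "dom_rel E V {v}" using uni[OF v] v by (auto simp: dom_rel_def)
  ultimately show "card C = 3" "card V = 3" using key[of "{v}" b] b v by auto
qed

section \<open>Tight products with an edge\<close>

text \<open>A nontrivial connected graph. Connectedness is stated through neighbour-closed sets,
  since \<open>V\<close> is identified below by exhibiting a small closed set.\<close>

locale connected_rel =
  fixes V :: "'a set" and E :: "'a rel"
  assumes finite_V: "finite V" and nonempty: "V \<noteq> {}"
    and sym_E: "sym E" and irrefl_E: "irrefl E" and E_subset: "E \<subseteq> V \<times> V"
    and nbr: "\<And>v. v \<in> V \<Longrightarrow> \<exists>u. (v, u) \<in> E"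
    and conn: "\<And>S. S \<subseteq> V \<Longrightarrow> S \<noteq> {} \<Longrightarrow> E `` S \<subseteq> S \<Longrightarrow> S = V"
begin

lemma symE': "(u, v) \<in> E \<Longrightarrow> (v, u) \<in> E"
  using sym_E by (rule symD)

lemma irreflE' [simp]: "(v, v) \<notin> E"
  using irrefl_E by (simp add: irrefl_def)

lemma in_V: "(u, v) \<in> E \<Longrightarrow> u \<in> V" "(u, v) \<in> E \<Longrightarrow> v \<in> V"
  using E_subset by auto

lemma finite_nbhd: "finite (E `` {v})"
  using finite_V E_subset by (auto intro: finite_subset[of _ V])

lemma card_nbhd_pos: "v \<in> V \<Longrightarrow> card (E `` {v}) > 0"
  using nbr finite_nbhd by (auto simp: card_gt_0_iff)

lemma leaf_if_not_two:
  assumes "v \<in> V" "\<not> card (E `` {v}) \<ge> 2"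
  obtains u where "E `` {v} = {u}"
proof -
  have "card (E `` {v}) = 1" using card_nbhd_pos[OF assms(1)] assms(2) by linarith
  then show thesis using that by (auto simp: card_1_singleton_iff)
qed

lemma two_nbrs:
  assumes "card (E `` {v}) \<ge> 2"
  obtains u where "(v, u) \<in> E" "u \<noteq> w"
proof -
  have "\<not> E `` {v} \<subseteq> {w}" using assms card_mono[of "{w}" "E `` {v}"] by auto
  then show thesis using that by blast
qed

lemma two_le_card_nbhd: "(v, u) \<in> E \<Longrightarrow> (v, w) \<in> E \<Longrightarrow> u \<noteq> w \<Longrightarrow> card (E `` {v}) \<ge> 2"
  using card_mono[OF finite_nbhd, of "{u, w}" v] by auto

end

text \<open>\<open>K\<close> only has to induce an edge on \<open>{c0, c1}\<close>; it may be the
  relation of a larger graph containing that edge.\<close>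

locale tight_K2_prod = connected_rel V E for V :: "'a set" and E +
  fixes K :: "'b rel" and c0 c1 :: 'b
  assumes K: "(c0, c1) \<in> K" "(c1, c0) \<in> K" "(c0, c0) \<notin> K" "(c1, c1) \<notin> K"
    and tight: "tight_rel (prod_rel K E) ({c0, c1} \<times> V)"
begin

text \<open>These are the \<open>b\<close> for which \<open>(c1, b)\<close> is not dominated by the
  copy of V - N(y) in layer \<open>c0\<close>.\<close>

definition dominated_nbhd :: "'a \<Rightarrow> 'a set" where
  "dominated_nbhd y = {b \<in> V. E `` {b} \<subseteq> E `` {y}}"

section \<open>Dominating sets spread over the two layers\<close>

lemma c_distinct: "c0 \<noteq> c1"
  using K by metis

lemma card_two_layers:
  assumes "A \<subseteq> V" "B \<subseteq> V"
  shows "card ({c0} \<times> A \<union> {c1} \<times> B) = card A + card B"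
  using assms finite_V c_distinct
  by (subst card_Un_disjoint) (auto simp: card_cartesian_product intro: finite_subset)

lemma dom_two_layers:
  assumes "A \<subseteq> V" "B \<subseteq> V"
    and "\<And>v. v \<in> V - A \<Longrightarrow> \<exists>u\<in>B. (u, v) \<in> E"
    and "\<And>v. v \<in> V - B \<Longrightarrow> \<exists>u\<in>A. (u, v) \<in> E"
  shows "dom_rel (prod_rel K E) ({c0, c1} \<times> V) ({c0} \<times> A \<union> {c1} \<times> B)"
  unfolding dom_rel_def
proof (intro conjI ballI)
  fix p assume "p \<in> {c0, c1} \<times> V"
  then consider v where "p = (c0, v)" "v \<in> V" | v where "p = (c1, v)" "v \<in> V" by auto
  then show "p \<in> {c0} \<times> A \<union> {c1} \<times> B
    \<or> (\<exists>q\<in>{c0} \<times> A \<union> {c1} \<times> B. (q, p) \<in> prod_rel K E)"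
  proof cases
    case (1 v)
    show ?thesis
    proof (cases "v \<in> A")
      case False
      then obtain u where "u \<in> B" "(u, v) \<in> E" using assms(3) 1 by blast
      then show ?thesis using 1 K by (intro disjI2 bexI[of _ "(c1, u)"]) auto
    qed (use 1 in simp)
  next
    case (2 v)
    show ?thesis
    proof (cases "v \<in> B")
      case False
      then obtain u where "u \<in> A" "(u, v) \<in> E" using assms(4) 2 by blast
      then show ?thesis using 2 K by (intro disjI2 bexI[of _ "(c0, u)"]) auto
    qed (use 2 in simp)
  qed
qed (use assms in auto)

lemma layer_independent_dominating:
  "indep_rel (prod_rel K E) ({c0} \<times> V \<union> {c1} \<times> {})"
  "dom_rel (prod_rel K E) ({c0, c1} \<times> V) ({c0} \<times> V \<union> {c1} \<times> {})"
proof -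
  show "indep_rel (prod_rel K E) ({c0} \<times> V \<union> {c1} \<times> {})"
    using K by (auto simp: indep_rel_def)
  show "dom_rel (prod_rel K E) ({c0, c1} \<times> V) ({c0} \<times> V \<union> {c1} \<times> {})"
  proof (rule dom_two_layers)
    show "\<exists>u\<in>V. (u, v) \<in> E" if "v \<in> V - {}" for v
      using that nbr symE' in_V(2) by blast
  qed auto
qed

text \<open>The full layer \<open>c0\<close> is independent and dominating and has
  \<open>card V\<close> vertices, so tightness bounds every dominating pair of layer sets from
  below.\<close>

lemma card_V_le_two_layers:
  assumes "A \<subseteq> V" "B \<subseteq> V"
    and "\<And>v. v \<in> V - A \<Longrightarrow> \<exists>u\<in>B. (u, v) \<in> E"
    and "\<And>v. v \<in> V - B \<Longrightarrow> \<exists>u\<in>A. (u, v) \<in> E"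
  shows "card V \<le> card A + card B"
  using tight_relD[OF tight layer_independent_dominating dom_two_layers[OF assms]]
    card_two_layers[OF assms(1,2)] card_two_layers[of V "{}"] by simp

lemma outside_dominated_nbhd:
  assumes "v \<in> V" "v \<notin> dominated_nbhd y"
  shows "\<exists>u\<in>V - E `` {y}. (u, v) \<in> E"
  using assms unfolding dominated_nbhd_def by (auto dest: symE' in_V)

lemma self_in_dominated_nbhd: "y \<in> V \<Longrightarrow> y \<in> dominated_nbhd y"
  by (simp add: dominated_nbhd_def)

lemma card_diff_nbhd: "card (V - E `` {y}) + card (E `` {y}) = card V"
proof -
  have "E `` {y} \<subseteq> V" using E_subset by blast
  then show ?thesis using finite_V finite_nbhd
    by (simp add: card_Diff_subset card_mono)
qed

text \<open>Take V - N(y) in layer \<open>c0\<close> and \<open>dominated_nbhd y\<close> in layer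
  \<open>c1\<close>. No edge joins the two, and \<open>(c1, y)\<close> dominates N(y) in layer
  \<open>c0\<close>, so this independent dominating set also has \<open>card V\<close>
  vertices.\<close>

lemma card_dominated_nbhd:
  assumes y: "y \<in> V"
  shows "card (dominated_nbhd y) = card (E `` {y})"
proof -
  let ?A = "V - E `` {y}" and ?B = "dominated_nbhd y"
  have sub: "?A \<subseteq> V" "?B \<subseteq> V" by (auto simp: dominated_nbhd_def)
  have "indep_rel (prod_rel K E) ({c0} \<times> ?A \<union> {c1} \<times> ?B)"
    using K unfolding indep_rel_def dominated_nbhd_def by (auto; blast dest: symE')
  moreover have "dom_rel (prod_rel K E) ({c0, c1} \<times> V) ({c0} \<times> ?A \<union> {c1} \<times> ?B)"
    using sub outside_dominated_nbhd self_in_dominated_nbhd[OF y]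
    by (intro dom_two_layers) auto
  ultimately have "card ({c0} \<times> ?A \<union> {c1} \<times> ?B) = card ({c0} \<times> V \<union> {c1} \<times> {})"
    using tight_rel_card_eq[OF tight] layer_independent_dominating by blast
  then have "card ?A + card ?B = card V"
    using card_two_layers[OF sub] card_two_layers[of V "{}"] by simp
  then show ?thesis using card_diff_nbhd[of y] by linarith
qed

text \<open>Adding \<open>x\<close> to layer \<open>c0\<close> costs one vertex, the summand 1, and
  relieves layer \<open>c1\<close> of those vertices of \<open>dominated_nbhd y\<close> that are
  adjacent to \<open>x\<close>.\<close>

lemma card_layers_update:
  assumes "y \<in> V" "(y, x) \<in> E"
  shows "card (insert x (V - E `` {y})) + card {b \<in> dominated_nbhd y. (x, b) \<notin> E}
    + card {b \<in> dominated_nbhd y. (x, b) \<in> E} = card V + 1"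
proof -
  have "finite (dominated_nbhd y)" using finite_V by (simp add: dominated_nbhd_def)
  then have "card {b \<in> dominated_nbhd y. (x, b) \<notin> E} + card {b \<in> dominated_nbhd y. (x, b) \<in> E}
      = card (dominated_nbhd y)"
    by (subst card_Un_disjoint[symmetric]) (auto intro: arg_cong[where f = card])
  moreover have "card (insert x (V - E `` {y})) = Suc (card (V - E `` {y}))"
    using finite_V assms(2) by simp
  ultimately show ?thesis
    using card_dominated_nbhd[OF assms(1)] card_diff_nbhd[of y] by linarith
qed

text \<open>The next two lemmas compare the layer \<open>{c0} \<times> V\<close> with the set obtained from
  \<open>{c0} \<times> (V - N(y) \<union> {x})\<close> by adding, in layer \<open>c1\<close>, the vertices that are not yet dominated;
  the vertex \<open>(c1, y)\<close> itself is needed only to dominate \<open>{c0} \<times> (N(y) - {x})\<close>.\<close>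

lemma dominated_nbhd_unique:
  assumes y: "y \<in> V" and x: "(y, x) \<in> E"
    and b: "b \<in> dominated_nbhd y" "b \<noteq> y" "(x, b) \<in> E"
    and b': "b' \<in> dominated_nbhd y" "b' \<noteq> y" "(x, b') \<in> E"
  shows "b = b'"
proof (rule ccontr)
  assume "b \<noteq> b'"
  let ?A = "insert x (V - E `` {y})" and ?U = "{b \<in> dominated_nbhd y. (x, b) \<notin> E}"
  have "card V \<le> card ?A + card (insert y ?U)"
  proof (rule card_V_le_two_layers)
    show "\<exists>u\<in>?A. (u, v) \<in> E" if "v \<in> V - insert y ?U" for v
      using that outside_dominated_nbhd[of v y] by blast
  qed (use y x in_V in \<open>auto simp: dominated_nbhd_def\<close>)
  moreover have "card (insert y ?U) \<le> Suc (card ?U)"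
    by (rule card_insert_le_m1) simp_all
  moreover have fin: "finite {b \<in> dominated_nbhd y. (x, b) \<in> E}"
    using finite_V by (simp add: dominated_nbhd_def)
  \<comment> \<open>At least \<open>y\<close>, \<open>b\<close> and \<open>b'\<close> leave layer
    \<open>c1\<close>, and only \<open>x\<close> and \<open>y\<close> are added, so the new
    dominating set has fewer than \<open>card V\<close> vertices.\<close>
  have "card {y, b, b'} \<le> card {b \<in> dominated_nbhd y. (x, b) \<in> E}"
    using y b b' x self_in_dominated_nbhd symE' by (intro card_mono fin) auto
  ultimately show False
    using card_layers_update[OF y x] b b' \<open>b \<noteq> b'\<close> by simp
qed

lemma dominated_nbhd_private:
  assumes y: "y \<in> V" and x: "(y, x) \<in> E"
    and b: "b \<in> dominated_nbhd y" "b \<noteq> y" "(x, b) \<in> E"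
  obtains a where "(y, a) \<in> E" "a \<noteq> x"
    "\<And>b'. b' \<in> dominated_nbhd y \<Longrightarrow> (a, b') \<in> E \<Longrightarrow> (x, b') \<in> E"
proof (rule ccontr)
  note obtained = that
  assume "\<not> thesis"
  then have dom: "\<exists>b'\<in>dominated_nbhd y. (a, b') \<in> E \<and> (x, b') \<notin> E" if "(y, a) \<in> E" "a \<noteq> x" for a
    using that obtained \<open>\<not> thesis\<close> by blast
  let ?A = "insert x (V - E `` {y})" and ?U = "{b \<in> dominated_nbhd y. (x, b) \<notin> E}"
  have "card V \<le> card ?A + card ?U"
  proof (rule card_V_le_two_layers)
    show "\<exists>u\<in>?A. (u, v) \<in> E" if "v \<in> V - ?U" for v
      using that outside_dominated_nbhd[of v y] by blast
    show "\<exists>u\<in>?U. (u, v) \<in> E" if "v \<in> V - ?A" for v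
      using that dom[of v] symE' by blast
  qed (use y x in_V in \<open>auto simp: dominated_nbhd_def\<close>)
  moreover have fin: "finite {b \<in> dominated_nbhd y. (x, b) \<in> E}"
    using finite_V by (simp add: dominated_nbhd_def)
  have "card {y, b} \<le> card {b \<in> dominated_nbhd y. (x, b) \<in> E}"
    using y b x self_in_dominated_nbhd symE' by (intro card_mono fin) auto
  ultimately show False
    using card_layers_update[OF y x] b by simp
qed

text \<open>The \<open>d - 1\<close> vertices \<open>b \<noteq> y\<close> with \<open>N(b) \<subseteq> N(y)\<close> have disjoint nonempty neighbourhoods
  inside the \<open>d\<close>-set \<open>N(y)\<close>, so all of them are leaves except for at most one of degree 2.\<close>

lemma support_or_twin:
  assumes y: "y \<in> V" and deg: "card (E `` {y}) \<ge> 2"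
  shows "(\<exists>z. \<forall>x. (y, x) \<in> E \<longrightarrow> x \<noteq> z \<longrightarrow> (\<exists>b. E `` {b} = {x}))
    \<or> (\<exists>b x a. b \<noteq> y \<and> x \<noteq> a \<and> E `` {y} = {x, a} \<and> E `` {b} = {x, a})"
proof -
  define S where "S = dominated_nbhd y - {y}"
  let ?N = "\<lambda>b. E `` {b}"
  have finS: "finite S" and SV: "S \<subseteq> V" using finite_V by (auto simp: S_def dominated_nbhd_def)
  have SN: "?N b \<subseteq> ?N y" if "b \<in> S" for b using that by (auto simp: S_def dominated_nbhd_def)
  have cardS: "Suc (card S) = card (?N y)"
    using card_dominated_nbhd[OF y] self_in_dominated_nbhd[OF y] finite_V deg unfolding S_def
    by (subst card_Suc_Diff1) (auto simp: dominated_nbhd_def)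
  have unique: "b = b'" if "b \<in> S" "b' \<in> S" "(b, x) \<in> E" "(b', x) \<in> E" for b b' x
    using dominated_nbhd_unique[OF y, of x b b'] that SN symE' unfolding S_def by blast
  have disj: "?N b \<inter> ?N b' = {}" if "b \<in> S" "b' \<in> S" "b \<noteq> b'" for b b'
    using unique that by blast
  have sum_eq: "card (\<Union>b\<in>S. ?N b) = (\<Sum>b\<in>S. card (?N b))"
    using finS finite_nbhd disj by (intro card_UN_disjoint) auto
  have UN_sub: "(\<Union>b\<in>S. ?N b) \<subseteq> ?N y" using SN by blast
  show ?thesis
  proof (cases "\<forall>b\<in>S. card (?N b) = 1")
    case True
    have "card (\<Union>b\<in>S. ?N b) = card S" using sum_eq True by simp
    then have "card (?N y - (\<Union>b\<in>S. ?N b)) = 1"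
      using cardS UN_sub finite_nbhd by (simp add: card_Diff_subset finite_subset[OF UN_sub])
    \<comment> \<open>The leaves in \<open>S\<close> hang on distinct neighbours of
      \<open>y\<close>, all but one of them; \<open>z\<close> is the one left over.\<close>
    then obtain z where z: "?N y - (\<Union>b\<in>S. ?N b) = {z}" by (auto simp: card_1_singleton_iff)
    have "\<exists>b. ?N b = {x}" if x: "(y, x) \<in> E" "x \<noteq> z" for x
    proof -
      obtain b where b: "b \<in> S" "x \<in> ?N b" using x z by blast
      then obtain x' where "?N b = {x'}" using True by (auto simp: card_1_singleton_iff)
      then have "?N b = {x}" using b(2) by (metis singletonD)
      then show ?thesis by blast
    qed
    then show ?thesis by blast
  next
    case False
    then obtain b0 where b0: "b0 \<in> S" "card (?N b0) \<noteq> 1" by blast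
    have pos: "card (?N b) \<ge> 1" if "b \<in> S" for b using card_nbhd_pos[of b] SV that by force
    \<comment> \<open>The disjoint neighbourhoods fit into \<open>card S + 1\<close> vertices, so
      only that of \<open>b0\<close> has a second element, and together they exhaust N(y).\<close>
    have "card (\<Union>b\<in>S. ?N b) \<le> Suc (card S)"
      using cardS card_mono[OF finite_nbhd UN_sub] by simp
    then have le: "card (?N b0) + (\<Sum>b\<in>S - {b0}. card (?N b)) \<le> 2 + card (S - {b0})"
      using sum_eq sum.remove[OF finS b0(1), of "\<lambda>b. card (?N b)"] card_Suc_Diff1[OF finS b0(1)] by simp
    have ge: "(\<Sum>b\<in>S - {b0}. card (?N b)) \<ge> card (S - {b0})"
      using sum_mono[of "S - {b0}" "\<lambda>_. 1" "\<lambda>b. card (?N b)"] pos by simp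
    have c0: "card (?N b0) = 2" using le ge pos[OF b0(1)] b0(2) by linarith
    then have s: "(\<Sum>b\<in>S - {b0}. card (?N b)) = card (S - {b0})" using le ge by linarith
    have one: "card (?N b) = 1" if "b \<in> S - {b0}" for b
    proof (rule ccontr)
      assume "card (?N b) \<noteq> 1"
      then have "(\<Sum>b\<in>S - {b0}. 1) < (\<Sum>b\<in>S - {b0}. card (?N b))"
        using that pos finS by (intro sum_strict_mono_ex1) (force simp: le_less)+
      then show False using s by simp
    qed
    have "card (\<Union>b\<in>S. ?N b) = card (?N y)"
      using sum_eq sum.remove[OF finS b0(1), of "\<lambda>b. card (?N b)"] card_Suc_Diff1[OF finS b0(1)] cardS s c0
      by simp
    then have UN_eq: "(\<Union>b\<in>S. ?N b) = ?N y"
      using UN_sub finite_nbhd by (simp add: card_subset_eq)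
    \<comment> \<open>Another \<open>b\<close> in \<open>S\<close> would be a leaf on some
      \<open>x\<close>. The \<open>a\<close> supplied by \<open>dominated_nbhd_private\<close> has a
      neighbour \<open>b'\<close> in \<open>S\<close>, which is then adjacent to \<open>x\<close>
      too. Uniqueness gives \<open>b' = b\<close>, although \<open>x\<close> is the only neighbour
      of \<open>b\<close>.\<close>
    have "S = {b0}"
    proof (rule ccontr)
      assume "S \<noteq> {b0}"
      then obtain b where b: "b \<in> S" "b \<noteq> b0" using b0 by blast
      then obtain x where x: "?N b = {x}" using one by (auto simp: card_1_singleton_iff)
      have bx: "(b, x) \<in> E" using x by blast
      obtain a where a: "(y, a) \<in> E" "a \<noteq> x"
        "\<And>b'. b' \<in> dominated_nbhd y \<Longrightarrow> (a, b') \<in> E \<Longrightarrow> (x, b') \<in> E"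
        using dominated_nbhd_private[OF y, of x b] b SN[OF b(1)] bx symE' unfolding S_def by blast
      then obtain b' where b': "b' \<in> S" "(b', a) \<in> E" using UN_eq by blast
      then have "(b', x) \<in> E" using a(3) symE' unfolding S_def by blast
      then have "b' = b" using unique b b' bx by blast
      then show False using b' x a(2) by blast
    qed
    then have "card (?N y) = 2" "?N b0 = ?N y" "b0 \<noteq> y"
      using cardS UN_eq b0 by (auto simp: S_def)
    then show ?thesis by (metis card_2_iff)
  qed
qed

end

text \<open>\<open>S\<close> is the vertex set of the base graph and \<open>l\<close> sends each of
  its vertices to the attached leaf. Connectedness is kept out, as the notion is also applied to
  products with an edge, which may be disconnected.\<close>

definition corona_rel :: "'a set \<Rightarrow> 'a rel \<Rightarrow> 'a set \<Rightarrow> ('a \<Rightarrow> 'a) \<Rightarrow> bool" where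
  "corona_rel V E S l \<longleftrightarrow> S \<subseteq> V \<and> bij_betw l S (V - S) \<and> (\<forall>s\<in>S. E `` {l s} = {s})"

definition C4_rel :: "'a set \<Rightarrow> 'a rel \<Rightarrow> 'a \<Rightarrow> 'a \<Rightarrow> 'a \<Rightarrow> 'a \<Rightarrow> bool" where
  "C4_rel V E a b c d \<longleftrightarrow> distinct [a, b, c, d] \<and> V = {a, b, c, d}
    \<and> E = {(a, b), (b, a), (b, c), (c, b), (c, d), (d, c), (d, a), (a, d)}"

section \<open>Factors of tight products with an edge: 4-cycles and coronas\<close>

context tight_K2_prod
begin

text \<open>Neither \<open>y\<close> nor \<open>b\<close> carries a leaf, since such a leaf would be
  \<open>x\<close> or \<open>a\<close>, both adjacent to \<open>y\<close> and \<open>b\<close>. So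
  \<open>support_or_twin\<close> at \<open>x\<close> and at \<open>a\<close> leaves only degree 2,
  and the four vertices form a closed set.\<close>

lemma C4_if_twins:
  assumes ne: "b \<noteq> y" "x \<noteq> a" and N: "E `` {y} = {x, a}" "E `` {b} = {x, a}"
  shows "C4_rel V E y x b a"
proof -
  have E': "(x, y) \<in> E" "(x, b) \<in> E" "(a, y) \<in> E" "(a, b) \<in> E" using N by (blast intro: symE')+
  have Nz: "E `` {z} = {y, b}" if z: "z = x \<or> z = a" for z
  proof -
    have zE: "(z, y) \<in> E" "(z, b) \<in> E" using z E' by blast+
    have "card (E `` {z}) \<ge> 2" using two_le_card_nbhd zE ne by blast
    moreover have "\<not> E `` {l} = {t}" if "t = y \<or> t = b" for l t
    proof
      assume l: "E `` {l} = {t}"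
      then have "(t, l) \<in> E" by (blast intro: symE')
      then have "l = x \<or> l = a" using that N by blast
      then have "{y, b} \<subseteq> E `` {l}" using E' by blast
      then show False unfolding l using ne(1) by auto
    qed
    ultimately obtain p q where pq: "E `` {z} = {p, q}"
      using support_or_twin[of z] zE in_V ne(1) by metis
    have "y \<in> E `` {z}" "b \<in> E `` {z}" using zE by auto
    then show ?thesis unfolding pq using ne(1) by auto
  qed
  have V_eq: "{y, x, b, a} = V"
    using N Nz[of x] Nz[of a] E' in_V by (intro conn) auto
  have "distinct [y, x, b, a]" using ne E' by auto
  moreover have "E = {(y, x), (x, y), (x, b), (b, x), (b, a), (a, b), (a, y), (y, a)}" (is "E = ?R")
  proof
    show "E \<subseteq> ?R"
    proof
      fix p assume "p \<in> E"
      then obtain u v where p: "p = (u, v)" "(u, v) \<in> E" by (cases p) blast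
      then have "u \<in> {y, x, b, a}" using in_V(1) V_eq by blast
      moreover have "v \<in> E `` {u}" using p by blast
      ultimately show "p \<in> ?R" using N Nz[of x] Nz[of a] p(1) by auto
    qed
    show "?R \<subseteq> E" using N E' by auto
  qed
  ultimately show ?thesis using V_eq unfolding C4_rel_def by simp
qed

text \<open>Unless the graph is a 4-cycle, at most one neighbour of a vertex of degree at least 2
  carries no leaf. Each such vertex then carries exactly one leaf, and these vertices are the base
  of a corona; a single edge is treated apart.\<close>

lemma C4_or_corona:
  "(\<exists>a b c d. C4_rel V E a b c d) \<or> (\<exists>S l. corona_rel V E S l)"
proof (cases "\<exists>a b c d. C4_rel V E a b c d")
  case False
  have supp: "\<exists>z. \<forall>x. (y, x) \<in> E \<longrightarrow> x \<noteq> z \<longrightarrow> (\<exists>b. E `` {b} = {x})"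
    if "y \<in> V" "card (E `` {y}) \<ge> 2" for y
    using support_or_twin[OF that] C4_if_twins False by blast
  \<comment> \<open>A neighbour \<open>x\<close> of \<open>y\<close> carries a leaf
    \<open>b\<close>. As \<open>b\<close> carries none, it is the exceptional neighbour
    \<open>z'\<close> of \<open>x\<close>; hence \<open>y\<close>, another neighbour of
    \<open>x\<close>, carries a leaf.\<close>
  have leaf_ex: "\<exists>l. E `` {l} = {y}" if y: "y \<in> V" "card (E `` {y}) \<ge> 2" for y
  proof -
    obtain z where z: "\<And>x. (y, x) \<in> E \<Longrightarrow> x \<noteq> z \<Longrightarrow> \<exists>b. E `` {b} = {x}" using supp[OF y] by blast
    obtain x where x: "(y, x) \<in> E" "x \<noteq> z" using two_nbrs[OF y(2)] by blast
    then obtain b where b: "E `` {b} = {x}" using z by blast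
    have xy: "(x, y) \<in> E" "(x, b) \<in> E" "b \<noteq> y" using x b y(2) by (auto intro: symE')
    then have dx: "x \<in> V" "card (E `` {x}) \<ge> 2" using two_le_card_nbhd in_V by blast+
    obtain z' where z': "\<And>w. (x, w) \<in> E \<Longrightarrow> w \<noteq> z' \<Longrightarrow> \<exists>b. E `` {b} = {w}" using supp[OF dx] by blast
    have "\<not> (\<exists>l. E `` {l} = {b})"
    proof
      assume "\<exists>l. E `` {l} = {b}"
      then obtain l where l: "E `` {l} = {b}" by blast
      then have "(b, l) \<in> E" by (blast intro: symE')
      then have "l = x" using b by blast
      then show False using l dx(2) by simp
    qed
    then have "b = z'" using z' xy by blast
    then show ?thesis using z' xy by blast
  qed
  \<comment> \<open>Two leaves at \<open>y\<close> would be two neighbours of \<open>y\<close> that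
    carry no leaf themselves.\<close>
  have leaf_unique: "l = l'" if y: "y \<in> V" "card (E `` {y}) \<ge> 2" and l: "E `` {l} = {y}" "E `` {l'} = {y}" for y l l'
  proof (rule ccontr)
    assume "l \<noteq> l'"
    obtain z where z: "\<And>x. (y, x) \<in> E \<Longrightarrow> x \<noteq> z \<Longrightarrow> \<exists>b. E `` {b} = {x}" using supp[OF y] by blast
    have no: "\<not> (\<exists>b. E `` {b} = {k})" if k: "E `` {k} = {y}" for k
    proof
      assume "\<exists>b. E `` {b} = {k}"
      then obtain b where b: "E `` {b} = {k}" by blast
      then have "(k, b) \<in> E" by (blast intro: symE')
      then have "b = y" using k by blast
      then show False using b y(2) by simp
    qed
    have "(y, l) \<in> E" "(y, l') \<in> E" using l by (blast intro: symE')+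
    then show False using z no l \<open>l \<noteq> l'\<close> by metis
  qed
  show ?thesis
  \<comment> \<open>Two leaves adjacent to each other make up \<open>V\<close>, the corona of a
    single vertex.\<close>
  proof (cases "\<exists>u v. E `` {u} = {v} \<and> E `` {v} = {u}")
    case True
    then obtain u v where uv: "E `` {u} = {v}" "E `` {v} = {u}" by blast
    then have "(u, v) \<in> E" by blast
    then have "u \<noteq> v" "u \<in> V" "v \<in> V" using in_V by auto
    then have "{u, v} = V" using uv by (intro conn) auto
    then have "corona_rel V E {u} (\<lambda>_. v)"
      using uv \<open>u \<noteq> v\<close> by (auto simp: corona_rel_def bij_betw_def)
    then show ?thesis by blast
  next
    case no_K2: False
    define S where "S = {v \<in> V. card (E `` {v}) \<ge> 2}"
    define l where "l s = (SOME l. E `` {l} = {s})" for s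
    have l: "E `` {l s} = {s}" if "s \<in> S" for s
      using someI_ex[OF leaf_ex[of s]] that by (simp add: l_def S_def)
    have lS: "l s \<in> V - S" if "s \<in> S" for s
      using l[OF that] in_V by (auto simp: S_def)
    have "V - S \<subseteq> l ` S"
    proof
      fix v assume v: "v \<in> V - S"
      then obtain u where u: "E `` {v} = {u}" using leaf_if_not_two[of v] by (auto simp: S_def)
      then have "(u, v) \<in> E" by (blast intro: symE')
      then have uV: "u \<in> V" by (rule in_V)
      have uS: "u \<in> S"
      proof (rule ccontr)
        assume "u \<notin> S"
        then obtain w where "E `` {u} = {w}" using leaf_if_not_two[OF uV] uV by (auto simp: S_def)
        then have "E `` {u} = {v}" using \<open>(u, v) \<in> E\<close> by (metis ImageI singletonD singletonI)
        then show False using u no_K2 by blast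
      qed
      then have "l u = v" using leaf_unique[of u] l u by (simp add: S_def)
      then show "v \<in> l ` S" using uS by blast
    qed
    then have "bij_betw l S (V - S)"
      using l lS unfolding bij_betw_def inj_on_def by (auto; metis singleton_inject)
    then have "corona_rel V E S l" using l by (auto simp: corona_rel_def S_def)
    then show ?thesis by blast
  qed
qed simp

end

section \<open>From graphs to relations\<close>

lemma connected_relI:
  assumes "pair_graph G" "connected (with_proj G)" "card (pverts G) \<ge> 2"
  shows "connected_rel (pverts G) (parcs G)"
proof -
  interpret pair_graph G by fact
  have sym: "sym (parcs G)" using arcs_symmetric by (auto simp: sym_def)
  have reach: "(u, v) \<in> rtrancl_on (pverts G) (parcs G)" if "u \<in> pverts G" "v \<in> pverts G" for u v
  proof -
    have "(parcs G)\<^sup>s = parcs G" using sym by (auto simp: symcl_def sym_def)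
    then show ?thesis using that assms(2) by (auto simp: connected_conv)
  qed
  have conn: "S = pverts G" if S: "S \<subseteq> pverts G" "S \<noteq> {}" "parcs G `` S \<subseteq> S" for S
  proof -
    obtain s where s: "s \<in> S" using S(2) by blast
    have "v \<in> S" if "v \<in> pverts G" for v
    proof -
      have "(s, v) \<in> rtrancl_on (pverts G) (parcs G)" using reach s S(1) that by blast
      then show ?thesis using s S(3) by (induction rule: rtrancl_on_induct) blast+
    qed
    then show ?thesis using S(1) by blast
  qed
  show ?thesis
  proof
    show "finite (pverts G)" by (rule pair_finite_verts)
    show "pverts G \<noteq> {}" using assms(3) by auto
    show "irrefl (parcs G)" using no_loops' by (auto simp: irrefl_def)
    show "parcs G \<subseteq> pverts G \<times> pverts G" using in_arcsD1 in_arcsD2 by auto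
    show "\<exists>u. (v, u) \<in> parcs G" if "v \<in> pverts G" for v
    proof (rule ccontr)
      assume "\<nexists>u. (v, u) \<in> parcs G"
      then have "{v} = pverts G" using that by (intro conn) auto
      then show False using assms(3) by (metis Suc_1 card_eq_0_iff card_1_singleton_iff not_less_eq_eq One_nat_def le_refl)
    qed
  qed (use sym conn in auto)
qed

lemma dominating_set_iff: "dominating_set (with_proj X) D \<longleftrightarrow> dom_rel (parcs X) (pverts X) D"
  by (auto simp: dominating_set_def dom_rel_def closed_nbhd_def)

text \<open>Every dominating set contains a minimal one, and an independent dominating set is itself
  minimal, because a removed vertex has no neighbour in the rest.\<close>

lemma tight_rel_if_well_dominated:
  assumes "finite (pverts X)" and wd: "well_dominated (with_proj X)"
  shows "tight_rel (parcs X) (pverts X)"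
  unfolding tight_rel_def
proof (intro allI impI)
  fix I D
  assume I: "indep_rel (parcs X) I" "dom_rel (parcs X) (pverts X) I"
    and D: "dom_rel (parcs X) (pverts X) D"
  have finD: "finite D" using D assms(1) by (auto simp: dom_rel_def intro: finite_subset)
  let ?P = "{D'. D' \<subseteq> D \<and> dom_rel (parcs X) (pverts X) D'}"
  have "finite ?P" using finD by (auto intro: finite_subset[of _ "Pow D"])
  then obtain D' where D': "D' \<in> ?P" and min: "\<And>K. K \<in> ?P \<Longrightarrow> K \<subseteq> D' \<Longrightarrow> D' = K"
    using finite_has_minimal2[of ?P D] D by auto
  have "minimal_dominating_set (with_proj X) D'"
    unfolding minimal_dominating_set_def dominating_set_iff using D' min by blast
  moreover have "minimal_dominating_set (with_proj X) I"
    unfolding minimal_dominating_set_def dominating_set_iff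
  proof (intro conjI allI impI)
    fix K assume "K \<subset> I"
    then obtain v where "v \<in> I" "v \<notin> K" by blast
    then show "\<not> dom_rel (parcs X) (pverts X) K"
      using \<open>K \<subset> I\<close> I unfolding dom_rel_def indep_rel_def by blast
  qed (rule I(2))
  ultimately have "card I = card D'" using wd unfolding well_dominated_def by blast
  then show "card I \<le> card D" using D' card_mono[OF finD] by simp
qed

lemma well_dominatedI:
  assumes "\<And>D. dom_rel (parcs X) (pverts X) D \<Longrightarrow>
    (\<And>d. d \<in> D \<Longrightarrow> \<not> dom_rel (parcs X) (pverts X) (D - {d})) \<Longrightarrow> card D = k"
  shows "well_dominated (with_proj X)"
proof -
  have "card D = k" if "minimal_dominating_set (with_proj X) D" for D
    using that unfolding minimal_dominating_set_def dominating_set_iff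
    by (intro assms) blast+
  then show ?thesis by (auto simp: well_dominated_def)
qed

lemma isolatableI:
  assumes "J \<subseteq> pverts G" "indep_rel (parcs G) J" "x \<in> pverts G - J - parcs G `` J"
    and "\<And>y. y \<in> pverts G - J - parcs G `` J \<Longrightarrow> (x, y) \<notin> parcs G"
  shows "isolatable (with_proj G) x"
proof -
  have "verts (with_proj G) - closed_nbhd (with_proj G) J = pverts G - J - parcs G `` J"
    by (auto simp: closed_nbhd_def)
  then show ?thesis
    unfolding isolatable_def isolated_vertex_def
    using assms by (intro exI[of _ J]) (auto simp: independent_set_def indep_rel_def arcs_ends_conv induce_subgraph_def)
qed

section \<open>Isolatable vertices of coronas and 4-cycles\<close>

lemma corona_rel_edge_between_supports:
  assumes "connected_rel V E" "corona_rel V E S l" "card V \<ge> 3"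
  obtains s t where "s \<in> S" "t \<in> S" "(s, t) \<in> E"
proof -
  interpret connected_rel V E by fact
  have S: "S \<subseteq> V" "bij_betw l S (V - S)" and l: "\<And>s. s \<in> S \<Longrightarrow> E `` {l s} = {s}"
    using assms(2) by (auto simp: corona_rel_def)
  have "S \<noteq> {}" using S nonempty by (auto simp: bij_betw_def)
  then obtain s where s: "s \<in> S" by blast
  have ls: "l s \<in> V" using s S(2) by (auto simp: bij_betw_def)
  have "(s, l s) \<in> E" using l[OF s] by (blast intro: symE')
  show thesis
  proof (cases "E `` {s} \<subseteq> {l s}")
    case True
    then have "{s, l s} = V" using s S(1) ls l[OF s] by (intro conn) auto
    moreover have "card {s, l s} \<le> 2" by (simp add: card_insert_if)
    ultimately show thesis using assms(3) by simp
  next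
    case False
    then obtain t where t: "(s, t) \<in> E" "t \<noteq> l s" by blast
    have "t \<in> S"
    proof (rule ccontr)
      assume "t \<notin> S"
      then obtain s' where s': "s' \<in> S" "t = l s'" using t(1) in_V(2) S(2) unfolding bij_betw_def by blast
      then have "s \<in> {s'}" using t(1) l[OF s'(1)] symE' by blast
      then show False using s' t(2) by simp
    qed
    then show thesis using that s t(1) by blast
  qed
qed

text \<open>For adjacent base vertices \<open>s\<close> and \<open>t\<close>, deleting the closed
  neighbourhood of \<open>t\<close> removes \<open>s\<close>, the only neighbour of the leaf
  \<open>l s\<close>, but not that leaf.\<close>

lemma corona_isolatable:
  assumes "connected_rel (pverts G) (parcs G)" "corona_rel (pverts G) (parcs G) S l"
    and "card (pverts G) \<ge> 3"
  shows "\<exists>x\<in>pverts G. isolatable (with_proj G) x"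
proof -
  interpret connected_rel "pverts G" "parcs G" by fact
  obtain s t where st: "s \<in> S" "t \<in> S" "(s, t) \<in> parcs G"
    using corona_rel_edge_between_supports assms by metis
  have l: "parcs G `` {l s} = {s}" and ls: "l s \<in> pverts G" "l s \<notin> S"
    using assms(2) st(1) by (auto simp: corona_rel_def bij_betw_def)
  have nb: "y = s" if "(l s, y) \<in> parcs G" for y using l that by blast
  have "t \<in> pverts G" "t \<noteq> s" using st in_V by auto
  have "(t, l s) \<notin> parcs G"
  proof
    assume "(t, l s) \<in> parcs G"
    then have "t \<in> {s}" using symE' l by blast
    then show False using \<open>t \<noteq> s\<close> by simp
  qed
  then have "isolatable (with_proj G) (l s)"
    using st ls \<open>t \<in> pverts G\<close> nb symE'
    by (intro isolatableI[of "{t}"]) (auto simp: indep_rel_def)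
  then show ?thesis using ls by blast
qed

lemma C4_isolatable:
  assumes "C4_rel (pverts G) (parcs G) a b c d"
  shows "\<exists>x\<in>pverts G. isolatable (with_proj G) x"
proof -
  \<comment> \<open>Only the vertex opposite to \<open>a\<close> survives the deletion of the closed
    neighbourhood of \<open>a\<close>.\<close>
  have "isolatable (with_proj G) c"
    using assms by (intro isolatableI[of "{a}"]) (auto simp: indep_rel_def C4_rel_def)
  then show ?thesis using assms by (auto simp: C4_rel_def)
qed

text \<open>Deleting the closed neighbourhood of all leaves but one leaves a single edge.\<close>

lemma tight_corona_prod_edge:
  assumes fin: "finite V" "finite W" and sym: "sym E" "sym F"
    and cor: "corona_rel V E S l" and s: "s \<in> S"
    and nbr: "\<And>w. w \<in> W \<Longrightarrow> \<exists>u\<in>W. (u, w) \<in> F"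
    and tight: "tight_rel (prod_rel E F) (V \<times> W)"
  shows "tight_rel (prod_rel E F) ({s, l s} \<times> W)"
proof -
  have S: "S \<subseteq> V" "bij_betw l S (V - S)" and l: "\<And>s. s \<in> S \<Longrightarrow> E `` {l s} = {s}"
    using cor by (auto simp: corona_rel_def)
  let ?J = "l ` (S - {s})"
  have lS: "\<And>s. s \<in> S \<Longrightarrow> l s \<in> V - S" "inj_on l S" using S(2) by (auto simp: bij_betw_def)
  have J: "?J \<subseteq> V" "indep_rel E ?J"
  proof -
    show "?J \<subseteq> V" using lS by blast
    have "x \<in> S" if "u \<in> S" "(l u, x) \<in> E" for u x using l[OF that(1)] that by (metis ImageI singletonD singletonI)
    then show "indep_rel E ?J" using lS(1) unfolding indep_rel_def by blast
  qed
  have "E `` ?J = (\<Union>u\<in>S - {s}. E `` {l u})" by blast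
  also have "\<dots> = S - {s}" using l by simp
  finally have "E `` ?J = S - {s}" .
  moreover have "V = S \<union> l ` S" using S by (auto simp: bij_betw_def)
  ultimately have "V - ?J - E `` ?J = {s, l s}"
    using s lS by (auto simp: inj_on_def)
  then have "tight_rel (prod_rel F E) (W \<times> {s, l s})"
    using tight_prod_delete_closed_nbhd[OF fin(2,1) sym(2,1) nbr tight_rel_swap[OF tight] J] by simp
  then show ?thesis by (rule tight_rel_swap)
qed

text \<open>If \<open>v\<close> is a leaf with neighbour \<open>w\<close>, a vertex with no
  neighbour but \<open>v\<close> must be \<open>w\<close>, and then \<open>{v, w}\<close> would be
  all of \<open>V\<close>. Without leaves any \<open>v\<close> will do.\<close>

lemma (in connected_rel) all_but_one_totally_dominating:
  assumes "card V \<ge> 3"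
  obtains v where "v \<in> V" "\<And>w. w \<in> V \<Longrightarrow> \<exists>u\<in>V - {v}. (u, w) \<in> E"
proof (cases "\<exists>v\<in>V. \<not> card (E `` {v}) \<ge> 2")
  case True
  then obtain v where v: "v \<in> V" "\<not> card (E `` {v}) \<ge> 2" by blast
  then obtain w where w: "E `` {v} = {w}" using leaf_if_not_two by blast
  have "\<exists>u\<in>V - {v}. (u, x) \<in> E" if "x \<in> V" for x
  proof (rule ccontr)
    assume "\<not> ?thesis"
    then have x: "E `` {x} = {v}" using nbr[OF that] in_V symE' by blast
    then have "x \<in> E `` {v}" by (blast intro: symE')
    then have "x = w" using w by simp
    then have "{v, w} = V" using x w v(1) in_V by (intro conn) auto
    moreover have "card {v, w} \<le> 2" by (simp add: card_insert_if)
    ultimately show False using assms by simp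
  qed
  then show thesis using that v(1) by blast
next
  case False
  obtain v where v: "v \<in> V" using nonempty by blast
  have "\<exists>u\<in>V - {v}. (u, w) \<in> E" if "w \<in> V" for w
  proof -
    have "card (E `` {w}) \<ge> 2" using False that by blast
    then obtain u where "(w, u) \<in> E" "u \<noteq> v" by (rule two_nbrs)
    then show ?thesis using in_V(2) symE' by blast
  qed
  then show thesis using that v by blast
qed

text \<open>Every vertex of the 4-cycle is adjacent to \<open>a\<close> or \<open>b\<close>, so
  \<open>{a, b} \<times> (W - {v})\<close> dominates if all of \<open>W\<close> has neighbours in
  \<open>W - {v}\<close>. It is smaller than the independent dominating set
  \<open>{a, c} \<times> W\<close>.\<close>

lemma not_tight_C4_prod:
  assumes C4: "C4_rel V E a b c d" and W: "connected_rel W F" "card W \<ge> 3"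
  shows "\<not> tight_rel (prod_rel E F) (V \<times> W)"
proof
  assume tight: "tight_rel (prod_rel E F) (V \<times> W)"
  interpret connected_rel W F by fact
  obtain v where v: "v \<in> W" "\<And>w. w \<in> W \<Longrightarrow> \<exists>u\<in>W - {v}. (u, w) \<in> F"
    using all_but_one_totally_dominating W(2) by blast
  have V: "distinct [a, b, c, d]" "V = {a, b, c, d}"
    "E = {(a, b), (b, a), (b, c), (c, b), (c, d), (d, c), (d, a), (a, d)}"
    using C4 by (auto simp: C4_rel_def)
  let ?I = "{a, c} \<times> W" and ?D = "{a, b} \<times> (W - {v})"
  have "indep_rel (prod_rel E F) ?I" using V by (auto simp: indep_rel_def)
  moreover have "dom_rel (prod_rel E F) (V \<times> W) ?I"
    unfolding dom_rel_def
  proof (intro conjI ballI)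
    fix p assume "p \<in> V \<times> W"
    then obtain g w where p: "p = (g, w)" "g \<in> V" "w \<in> W" by blast
    obtain u where "u \<in> W" "(u, w) \<in> F" using v(2) p(3) by blast
    then have "p \<in> ?I \<or> ((a, u) \<in> ?I \<and> ((a, u), p) \<in> prod_rel E F)" using p V by auto
    then show "p \<in> ?I \<or> (\<exists>q\<in>?I. (q, p) \<in> prod_rel E F)" by blast
  qed (use V in auto)
  moreover have "dom_rel (prod_rel E F) (V \<times> W) ?D"
    unfolding dom_rel_def
  proof (intro conjI ballI)
    fix p assume "p \<in> V \<times> W"
    then obtain g w where p: "p = (g, w)" "g \<in> V" "w \<in> W" by blast
    obtain u where u: "u \<in> W - {v}" "(u, w) \<in> F" using v(2) p(3) by blast
    then have "((a, u), p) \<in> prod_rel E F \<or> ((b, u), p) \<in> prod_rel E F" using p V by auto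
    moreover have "(a, u) \<in> ?D" "(b, u) \<in> ?D" using u by auto
    ultimately show "p \<in> ?D \<or> (\<exists>q\<in>?D. (q, p) \<in> prod_rel E F)" by blast
  qed (use V in auto)
  ultimately have "card ?I \<le> card ?D" using tight tight_relD by blast
  then have "2 * card W \<le> 2 * card (W - {v})" using V by (simp add: card_cartesian_product)
  then show False using v(1) finite_V card_Diff1_less[OF finite_V v(1)] by simp
qed

section \<open>Isomorphism types as conditions on relations\<close>

lemma digraph_iso_iff:
  assumes "pair_wf_digraph G" "pair_wf_digraph H"
  shows "digraph_iso (with_proj G) (with_proj H) \<longleftrightarrow>
    (\<exists>g. inj_on g (pverts H) \<and> pverts G = g ` pverts H \<and> parcs G = map_prod g g ` parcs H)"
    (is "?L \<longleftrightarrow> ?R")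
proof
  interpret G: pair_wf_digraph G by fact
  interpret H: pair_wf_digraph H by fact
  {
    assume ?L
    then have "digraph_iso (with_proj H) (with_proj G)"
      using digraph_iso_swap G.wf_digraph_axioms by blast
    then obtain f where f: "H.digraph_isomorphism f" and eq: "with_proj G = app_iso f (with_proj H)"
      by (auto simp: digraph_iso_def)
    have "pverts G = iso_verts f ` pverts H"
      using arg_cong[OF eq, of verts] by simp
    moreover have "parcs G = (\<lambda>(u, v). (iso_verts f u, iso_verts f v)) ` parcs H"
      using arg_cong[OF eq, of arcs_ends] H.arcs_ends_app_iso_eq[OF f] by simp
    moreover have "inj_on (iso_verts f) (pverts H)"
      using f by (simp add: H.digraph_isomorphism_def)
    ultimately show ?R by (intro exI[of _ "iso_verts f"]) (simp add: map_prod_def)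
  next
    assume ?R
    then obtain g where g: "inj_on g (pverts H)" "pverts G = g ` pverts H" "parcs G = map_prod g g ` parcs H"
      by blast
    \<comment> \<open>The arcs of a pair digraph are pairs of vertices, so the vertex map
      \<open>g\<close> determines the arc map.\<close>
    define f where "f = \<lparr>iso_verts = g, iso_arcs = map_prod g g, iso_head = snd, iso_tail = fst\<rparr>"
    have "inj_on (map_prod g g) (parcs H)"
      using map_prod_inj_on[OF g(1) g(1)] H.in_arcsD1 H.in_arcsD2 by (auto intro: inj_on_subset)
    then have "H.digraph_isomorphism f"
      using g(1) H.wf_digraph_axioms by (auto simp: H.digraph_isomorphism_def f_def)
    moreover have "with_proj G = app_iso f (with_proj H)"
      using g by (simp add: with_proj_def app_iso_def f_def)
    ultimately have "digraph_iso (with_proj H) (with_proj G)" by (auto simp: digraph_iso_def)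
    then show ?L using digraph_iso_swap H.wf_digraph_axioms by blast
  }
qed

lemma C4_iff_iso_cycle_graph:
  assumes "pair_wf_digraph G"
  shows "digraph_iso (with_proj G) (with_proj (cycle_graph 4)) \<longleftrightarrow>
    (\<exists>a b c d. C4_rel (pverts G) (parcs G) a b c d)"
proof -
  have "pair_wf_digraph (cycle_graph 4)"
    by unfold_locales (auto simp: cycle_graph_def)
  note iff = digraph_iso_iff[OF assms this, unfolded cycle_graph_4]
  show ?thesis
  proof
    assume "digraph_iso (with_proj G) (with_proj (cycle_graph 4))"
    then obtain g :: "nat \<Rightarrow> 'a" where g: "inj_on g {0, 1, 2, 3}" "pverts G = g ` {0, 1, 2, 3}"
      "parcs G = map_prod g g ` {(0,1), (1,0), (1,2), (2,1), (2,3), (3,2), (3,0), (0,3)}"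
      unfolding iff by blast
    then have "C4_rel (pverts G) (parcs G) (g 0) (g 1) (g 2) (g 3)"
      by (auto simp: C4_rel_def)
    then show "\<exists>a b c d. C4_rel (pverts G) (parcs G) a b c d" by blast
  next
    assume "\<exists>a b c d. C4_rel (pverts G) (parcs G) a b c d"
    then obtain a b c d where C4: "C4_rel (pverts G) (parcs G) a b c d" by blast
    define g where "g = (!) [a, b, c, d]"
    have g: "g 0 = a" "g 1 = b" "g 2 = c" "g 3 = d" by (simp_all add: g_def)
    have "distinct [g 0, g 1, g 2, g 3]" using C4 by (simp add: C4_rel_def g del: One_nat_def)
    then have "inj_on g {0, 1, 2, 3}" by auto
    moreover have "pverts G = g ` {0, 1, 2, 3}"
      using C4 by (simp add: C4_rel_def g del: One_nat_def)
    moreover have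
      "parcs G = map_prod g g ` {(0,1), (1,0), (1,2), (2,1), (2,3), (3,2), (3,0), (0,3)}"
      using C4 by (simp add: C4_rel_def g del: One_nat_def)
    ultimately show "digraph_iso (with_proj G) (with_proj (cycle_graph 4))"
      unfolding iff by blast
  qed
qed

lemma corona_relD:
  assumes "corona_rel V E S l"
  shows "S \<subseteq> V" "inj_on l S" "l ` S = V - S" "V = S \<union> l ` S"
    and "\<And>s x. s \<in> S \<Longrightarrow> (l s, x) \<in> E \<longleftrightarrow> x = s"
  using assms unfolding corona_rel_def bij_betw_def by blast+

lemma corona_of_connected_graph_iff:
  assumes "pair_graph G" "connected_rel (pverts G) (parcs G)"
  shows "corona_of_connected_graph G \<longleftrightarrow> (\<exists>S l. corona_rel (pverts G) (parcs G) S l)"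
proof -
  interpret G: pair_graph G by fact
  interpret connected_rel "pverts G" "parcs G" by fact
  have wf: "pair_wf_digraph G" ..
  show ?thesis
  proof
    assume "corona_of_connected_graph G"
    then obtain F :: "'a pair_pre_digraph" where F: "pair_graph F"
      and iso: "digraph_iso (with_proj G) (with_proj (corona_K1 F))"
      unfolding corona_of_connected_graph_def by blast
    interpret F: pair_graph F by fact
    interpret C: pair_graph "corona_K1 F" by (rule pair_graph_corona_K1[OF F])
    have wfC: "pair_wf_digraph (corona_K1 F)" ..
    obtain g where g: "inj_on g (pverts (corona_K1 F))" "pverts G = g ` pverts (corona_K1 F)"
      "parcs G = map_prod g g ` parcs (corona_K1 F)"
      using iso unfolding digraph_iso_iff[OF wf wfC] by blast
    define U where "U = pverts F"
    have pC: "pverts (corona_K1 F) = Inl ` U \<union> Inr ` U" by (simp add: corona_K1_def U_def)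
    have inj: "inj_on (\<lambda>u. g (Inl u)) U" "inj_on (\<lambda>u. g (Inr u)) U"
      "\<And>u v. u \<in> U \<Longrightarrow> v \<in> U \<Longrightarrow> g (Inl u) \<noteq> g (Inr v)"
      using g(1) unfolding pC by (auto simp: inj_on_def)
    define S where "S = (\<lambda>u. g (Inl u)) ` U"
    \<comment> \<open>\<open>l\<close> goes back from the image of \<open>Inl u\<close> to
      \<open>u\<close> and on to the image of its leaf \<open>Inr u\<close>.\<close>
    define l where "l s = g (Inr (inv_into U (\<lambda>u. g (Inl u)) s))" for s
    have l: "l (g (Inl u)) = g (Inr u)" if "u \<in> U" for u
      using inv_into_f_f[OF inj(1) that] by (simp add: l_def)
    have "bij_betw l S (pverts G - S)"
      unfolding bij_betw_def
    proof
      show "inj_on l S" using inj l by (auto simp: inj_on_def S_def)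
      have "l ` S = (\<lambda>u. g (Inr u)) ` U" using l by (force simp: S_def)
      also have "\<dots> = pverts G - S" using inj(3) unfolding g(2) pC S_def by fastforce
      finally show "l ` S = pverts G - S" .
    qed
    moreover have "parcs G `` {l s} = {s}" if "s \<in> S" for s
    proof -
      obtain u where u: "u \<in> U" "s = g (Inl u)" using \<open>s \<in> S\<close> by (auto simp: S_def)
      have "(Inr u, Inl u) \<in> parcs (corona_K1 F)" using u by (simp add: corona_K1_def U_def)
      then have "(g (Inr u), g (Inl u)) \<in> parcs G" unfolding g(3) by (metis imageI map_prod_simp)
      moreover have "x = g (Inl u)" if x: "(g (Inr u), x) \<in> parcs G" for x
      proof -
        obtain p q where pq: "(p, q) \<in> parcs (corona_K1 F)" "g (Inr u) = g p" "x = g q"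
          using x unfolding g(3) by auto
        have "p = Inr u"
          using inj_onD[OF g(1) pq(2)[symmetric]] C.in_arcsD1[OF pq(1)] u(1) unfolding pC by blast
        then show ?thesis using pq by (auto simp: corona_K1_def)
      qed
      ultimately have "parcs G `` {g (Inr u)} = {g (Inl u)}" by blast
      then show ?thesis using u l by simp
    qed
    moreover have "S \<subseteq> pverts G" unfolding S_def g(2) pC by blast
    ultimately show "\<exists>S l. corona_rel (pverts G) (parcs G) S l" unfolding corona_rel_def by blast
  next
    assume "\<exists>S l. corona_rel (pverts G) (parcs G) S l"
    then obtain S l where cor: "corona_rel (pverts G) (parcs G) S l" by blast
    note l = corona_relD[OF cor]
    define F where "F = \<lparr>pverts = S, parcs = parcs G \<inter> S \<times> S\<rparr>"
    have symF: "sym (parcs F)" using sym_E by (auto simp: F_def sym_def)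
    have "finite S" "finite (parcs F)"
      using l(1) G.pair_finite_verts G.pair_finite_arcs by (auto simp: F_def intro: finite_subset)
    then have F: "pair_graph F"
      using symF by unfold_locales (auto simp: F_def symmetric_def)
    interpret F: pair_graph F by fact
    interpret C: pair_graph "corona_K1 F" by (rule pair_graph_corona_K1[OF F])
    have wfC: "pair_wf_digraph (corona_K1 F)" ..
    have leaf: "(x, l s) \<in> parcs G \<longleftrightarrow> x = s" if "s \<in> S" for s x
      using l(5)[OF that] symE' by blast
    have "(u, v) \<in> rtrancl_on S (parcs F)" if uv: "u \<in> S" "v \<in> S" for u v
    proof -
      \<comment> \<open>The vertices reachable from \<open>u\<close> within \<open>S\<close>,
        together with their leaves, form a neighbour-closed set, since a leaf leads only back to its
        own support; hence they are all of \<open>pverts G\<close>.\<close>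
      define T where "T = {t \<in> S. (u, t) \<in> rtrancl_on S (parcs F)}"
      have "x \<in> T \<union> l ` T" if t: "t \<in> T" and x: "(t, x) \<in> parcs G" for t x
      proof (cases "x \<in> S")
        case True
        then have "(t, x) \<in> parcs F" using t x by (simp add: F_def T_def)
        then show ?thesis using t True by (auto simp: T_def intro: rtrancl_on_into_rtrancl_on)
      next
        case False
        then obtain s where "s \<in> S" "x = l s" using in_V(2)[OF x] l(4) by blast
        then have "t = s" using leaf x by simp
        then show ?thesis using \<open>x = l s\<close> t by blast
      qed
      moreover have "x \<in> T" if "t \<in> T" "(l t, x) \<in> parcs G" for t x
        using that l(5) by (auto simp: T_def)
      ultimately have "parcs G `` (T \<union> l ` T) \<subseteq> T \<union> l ` T" by blast
      moreover have "u \<in> T" "T \<subseteq> S" using uv(1) by (auto simp: T_def)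
      ultimately have "T \<union> l ` T = pverts G" using l(4) by (intro conn) blast+
      then have "v \<in> T" using uv(2) l(1,3) \<open>T \<subseteq> S\<close> by blast
      then show ?thesis by (simp add: T_def)
    qed
    moreover have "(parcs F)\<^sup>s = parcs F" using symF by (auto simp: symcl_def sym_def)
    moreover have "S \<noteq> {}" using l(4) nonempty by blast
    ultimately have conF: "connected (with_proj F)"
      by (simp add: connected_conv F_def)
    define g where "g = case_sum (\<lambda>s. s) l"
    have pC: "pverts (corona_K1 F) = Inl ` S \<union> Inr ` S" by (simp add: corona_K1_def F_def)
    have ls: "l s \<notin> S" if "s \<in> S" for s using l(3) that by blast
    have "inj_on g (Inl ` S)" "inj_on g (Inr ` S)" "g ` Inl ` S \<inter> g ` Inr ` S = {}"
      using l(2) ls by (auto simp: inj_on_def g_def)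
    then have "inj_on g (pverts (corona_K1 F))"
      unfolding pC inj_on_Un by blast
    moreover have "pverts G = g ` pverts (corona_K1 F)"
      using l(4) unfolding pC g_def by (simp add: image_Un image_image)
    moreover have "parcs G = map_prod g g ` parcs (corona_K1 F)"
    proof -
      have "parcs (corona_K1 F) =
          map_prod Inl Inl ` (parcs G \<inter> S \<times> S) \<union> (\<lambda>u. (Inl u, Inr u)) ` S \<union> (\<lambda>u. (Inr u, Inl u)) ` S"
        unfolding corona_K1_def F_def map_prod_def by auto
      then have "map_prod g g ` parcs (corona_K1 F) =
          (parcs G \<inter> S \<times> S) \<union> (\<lambda>u. (u, l u)) ` S \<union> (\<lambda>u. (l u, u)) ` S"
        by (simp add: image_Un image_image g_def map_prod_def case_prod_beta)
      also have "\<dots> = parcs G"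
      proof
        show "(parcs G \<inter> S \<times> S) \<union> (\<lambda>u. (u, l u)) ` S \<union> (\<lambda>u. (l u, u)) ` S \<subseteq> parcs G"
          using l(5) leaf by blast
        show "parcs G \<subseteq> (parcs G \<inter> S \<times> S) \<union> (\<lambda>u. (u, l u)) ` S \<union> (\<lambda>u. (l u, u)) ` S"
        proof
          fix p assume "p \<in> parcs G"
          then obtain x y where p: "p = (x, y)" "(x, y) \<in> parcs G" by (cases p) blast
          then have "x \<in> S \<union> l ` S" "y \<in> S \<union> l ` S" using in_V l(4) by blast+
          then consider "x \<in> S" "y \<in> S" | s where "s \<in> S" "x = l s" | s where "s \<in> S" "y = l s"
            by blast
          then show "p \<in> (parcs G \<inter> S \<times> S) \<union> (\<lambda>u. (u, l u)) ` S \<union> (\<lambda>u. (l u, u)) ` S"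
            using p l(5) leaf by cases auto
        qed
      qed
      finally show ?thesis by (rule sym)
    qed
    ultimately show "corona_of_connected_graph G"
      unfolding corona_of_connected_graph_def digraph_iso_iff[OF wf wfC]
      using F conF digraph_iso_iff[OF wf wfC] by blast
  qed
qed

lemma direct_product_simps:
  "pverts (direct_product G H) = pverts G \<times> pverts H"
  "parcs (direct_product G H) = prod_rel (parcs G) (parcs H)"
  by (auto simp: direct_product_def prod_rel_def)

lemma complete_digraph_2E:
  assumes "complete_digraph 2 (with_proj G)"
  obtains c0 c1 where "c0 \<noteq> c1" "pverts G = {c0, c1}" "parcs G = {(c0, c1), (c1, c0)}"
proof -
  obtain c0 c1 where c: "pverts G = {c0, c1}" "c0 \<noteq> c1"
    using assms by (auto simp: complete_digraph_pair_def card_2_iff)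
  then have "parcs G = {(c0, c1), (c1, c0)}"
    using assms by (auto simp: complete_digraph_pair_def)
  then show thesis using that c by blast
qed

lemma complete_digraphI:
  assumes "connected_rel (pverts G) (parcs G)" "card (pverts G) = n"
    and "\<And>u v. u \<in> pverts G \<Longrightarrow> v \<in> pverts G \<Longrightarrow> (u, v) \<in> parcs G \<longleftrightarrow> u \<noteq> v"
  shows "complete_digraph n (with_proj G)"
proof -
  interpret connected_rel "pverts G" "parcs G" by fact
  have "parcs G = {(u, v). (u, v) \<in> pverts G \<times> pverts G \<and> u \<noteq> v}"
    using assms(3) in_V by fast
  then show ?thesis unfolding complete_digraph_pair_def using assms(2) finite_V by blast
qed

section \<open>The structure of the factors\<close>

lemma C4_or_corona_if_tight_K2_prod:
  assumes H: "pair_graph H" "connected_rel (pverts H) (parcs H)"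
    and K: "(c0, c1) \<in> K" "(c1, c0) \<in> K" "(c0, c0) \<notin> K" "(c1, c1) \<notin> K"
    and tight: "tight_rel (prod_rel K (parcs H)) ({c0, c1} \<times> pverts H)"
  shows "digraph_iso (with_proj H) (with_proj (cycle_graph 4)) \<or> corona_of_connected_graph H"
proof -
  interpret H: pair_graph H by fact
  interpret connected_rel "pverts H" "parcs H" by fact
  interpret tight_K2_prod "pverts H" "parcs H" K c0 c1
    using K tight by unfold_locales
  have "pair_wf_digraph H" ..
  then show ?thesis
    using C4_or_corona C4_iff_iso_cycle_graph corona_of_connected_graph_iff[OF H] by metis
qed

lemma card_2_complete_digraph:
  assumes "connected_rel (pverts G) (parcs G)" "card (pverts G) = 2"
  shows "complete_digraph 2 (with_proj G)"
proof -
  interpret connected_rel "pverts G" "parcs G" by fact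
  obtain a b where ab: "pverts G = {a, b}" "a \<noteq> b" using assms(2) by (auto simp: card_2_iff)
  have ab_E: "(a, b) \<in> parcs G" using nbr[of a] in_V ab by force
  show ?thesis
    using ab ab_E symE'[OF ab_E] by (intro complete_digraphI[OF assms]) auto
qed

lemma structure_if_tight:
  fixes G :: "'a pair_pre_digraph" and H :: "'b pair_pre_digraph"
  assumes G: "pair_graph G" "connected_rel (pverts G) (parcs G)"
    and H: "pair_graph H" "connected_rel (pverts H) (parcs H)"
    and noiso: "\<And>x. x \<in> pverts H \<Longrightarrow> \<not> isolatable (with_proj H) x"
    and tight: "tight_rel (prod_rel (parcs G) (parcs H)) (pverts G \<times> pverts H)"
  shows "(complete_digraph 3 (with_proj G) \<and> complete_digraph 3 (with_proj H)) \<or>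
    (complete_digraph 2 (with_proj H) \<and>
      (digraph_iso (with_proj G) (with_proj (cycle_graph 4)) \<or> corona_of_connected_graph G))"
proof -
  let ?VG = "pverts G" and ?EG = "parcs G" and ?VH = "pverts H" and ?EH = "parcs H"
  interpret G: connected_rel ?VG ?EG by fact
  interpret H: connected_rel ?VH ?EH by fact
  have nbrG: "\<exists>u\<in>?VG. (u, v) \<in> ?EG" if "v \<in> ?VG" for v
    using G.nbr[OF that] G.symE' G.in_V by blast
  have nbrH: "\<exists>u\<in>?VH. (u, v) \<in> ?EH" if "v \<in> ?VH" for v
    using H.nbr[OF that] H.symE' H.in_V by blast
  have noiso': "\<exists>y\<in>?VH - J - ?EH `` J. (x, y) \<in> ?EH"
    if "J \<subseteq> ?VH" "indep_rel ?EH J" "x \<in> ?VH - J - ?EH `` J" for J x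
    using isolatableI[OF that] noiso[of x] that(3) by blast
  have "\<exists>C\<subseteq>?VH. card C \<ge> 2 \<and> (\<forall>c\<in>C. \<forall>c'\<in>C. (c, c') \<in> ?EH \<longleftrightarrow> c \<noteq> c')
    \<and> tight_rel (prod_rel ?EG ?EH) (?VG \<times> C)"
    by (rule tight_prod_clique[OF G.finite_V H.finite_V G.nonempty H.nonempty G.sym_E H.sym_E
          H.irrefl_E nbrG tight noiso'])
  then obtain C where C: "C \<subseteq> ?VH" "card C \<ge> 2"
    "\<And>c c'. c \<in> C \<Longrightarrow> c' \<in> C \<Longrightarrow> (c, c') \<in> ?EH \<longleftrightarrow> c \<noteq> c'"
    "tight_rel (prod_rel ?EG ?EH) (?VG \<times> C)"
    by blast
  show ?thesis
  proof (cases "card C \<ge> 3")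
    case True
    have "\<exists>u. (u, v) \<in> ?EG" if "v \<in> ?VG" for v using nbrG[OF that] by blast
    note K3 = tight_prod_large_clique[OF G.finite_V G.nonempty G.sym_E G.irrefl_E G.E_subset
      this G.conn True C(3,4)]
    \<comment> \<open>Now that \<open>G\<close> is known to be complete on three vertices,
      \<open>pverts G\<close> itself serves as the clique for \<open>H\<close>.\<close>
    have "\<exists>u. (u, v) \<in> ?EH" if "v \<in> ?VH" for v using nbrH[OF that] by blast
    note K3' = tight_prod_large_clique[OF H.finite_V H.nonempty H.sym_E H.irrefl_E H.E_subset
      this H.conn _ K3(3) tight_rel_swap[OF tight]]
    have "complete_digraph 3 (with_proj G)"
      using K3 by (intro complete_digraphI[OF G(2)]) auto
    moreover have "complete_digraph 3 (with_proj H)"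
      using K3(2) K3' by (intro complete_digraphI[OF H(2)]) auto
    ultimately show ?thesis by blast
  next
    case False
    then have "card C = 2" using C(2) by linarith
    then obtain c0 c1 where c: "C = {c0, c1}" "c0 \<noteq> c1" by (auto simp: card_2_iff)
    \<comment> \<open>The clique is an edge of \<open>H\<close> and supplies the two layers over
      \<open>G\<close>.\<close>
    have G': "digraph_iso (with_proj G) (with_proj (cycle_graph 4)) \<or> corona_of_connected_graph G"
      using C(3) c tight_rel_swap[OF C(4)] by (intro C4_or_corona_if_tight_K2_prod[OF G]) auto
    have "card ?VH \<ge> 2" using C(1,2) H.finite_V card_mono le_trans by blast
    then consider "card ?VH = 2" | "card ?VH \<ge> 3" by linarith
    then show ?thesis
    proof cases
      case 1
      then show ?thesis using G' card_2_complete_digraph[OF H(2)] by blast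
    next
      case 2
      have wf: "pair_wf_digraph G" "pair_wf_digraph H"
        using G(1) H(1) by (simp_all add: pair_graph_def pair_digraph_def pair_fin_digraph_def)
      have no_C4: "\<not> C4_rel ?VG ?EG a b c d" for a b c d
        using not_tight_C4_prod[OF _ H(2) 2, of ?VG ?EG] tight by metis
      then have "corona_of_connected_graph G"
        using G' C4_iff_iso_cycle_graph[OF wf(1)] by blast
      then obtain S l where cor: "corona_rel ?VG ?EG S l"
        using corona_of_connected_graph_iff[OF G] by blast
      then obtain s where s: "s \<in> S" using corona_relD(4)[OF cor] G.nonempty by blast
      \<comment> \<open>Here an edge of \<open>G\<close> supplies the layers over \<open>H\<close>.
        Both possible outcomes for \<open>H\<close>, which has at least three vertices, give it an
        isolatable vertex.\<close>
      have tight_edge: "tight_rel (prod_rel ?EG ?EH) ({s, l s} \<times> ?VH)"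
        by (rule tight_corona_prod_edge[OF G.finite_V H.finite_V G.sym_E H.sym_E cor s nbrH tight])
      have "(l s, s) \<in> ?EG" using corona_relD(5)[OF cor s] by simp
      then have "digraph_iso (with_proj H) (with_proj (cycle_graph 4)) \<or> corona_of_connected_graph H"
        using tight_edge G.symE' by (intro C4_or_corona_if_tight_K2_prod[OF H, of s "l s" ?EG]) auto
      then have "\<exists>x\<in>?VH. isolatable (with_proj H) x"
        unfolding C4_iff_iso_cycle_graph[OF wf(2)] corona_of_connected_graph_iff[OF H]
        using C4_isolatable[of H] corona_isolatable[OF H(2) _ 2] by metis
      then show ?thesis using noiso by blast
    qed
  qed
qed

section \<open>Well-dominated products\<close>

text \<open>Well-domination with the common cardinality named. Minimality is tested on the removal
  of single vertices, the form that yields private neighbours.\<close>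

definition wd_rel :: "'a rel \<Rightarrow> 'a set \<Rightarrow> nat \<Rightarrow> bool" where
  "wd_rel E V k \<longleftrightarrow>
    (\<forall>D. dom_rel E V D \<longrightarrow> (\<forall>d\<in>D. \<not> dom_rel E V (D - {d})) \<longrightarrow> card D = k)"

lemma wd_rel_swap:
  assumes "wd_rel (prod_rel E F) (V \<times> W) k"
  shows "wd_rel (prod_rel F E) (W \<times> V) k"
  unfolding wd_rel_def
proof (intro allI impI)
  fix D
  assume D: "dom_rel (prod_rel F E) (W \<times> V) D"
    and min: "\<forall>d\<in>D. \<not> dom_rel (prod_rel F E) (W \<times> V) (D - {d})"
  have "\<not> dom_rel (prod_rel E F) (V \<times> W) (prod.swap ` D - {d})" if "d \<in> prod.swap ` D" for d
  proof
    assume "dom_rel (prod_rel E F) (V \<times> W) (prod.swap ` D - {d})"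
    moreover obtain d' where d': "d' \<in> D" "d = prod.swap d'" using \<open>d \<in> _\<close> by blast
    then have "prod.swap ` (prod.swap ` D - {d}) = D - {d'}"
      by (simp add: image_set_diff[OF inj_swap] image_image)
    ultimately show False using dom_rel_swap min d'(1) by metis
  qed
  then have "card (prod.swap ` D) = k"
    using assms dom_rel_swap[OF D] unfolding wd_rel_def by blast
  then show "card D = k" by (simp add: card_image)
qed

text \<open>A minimal dominating set contains exactly one vertex of each pair \<open>{s, l s}\<close>.\<close>

lemma wd_rel_corona:
  assumes "sym E" and cor: "corona_rel V E S l"
  shows "wd_rel E V (card S)"
  unfolding wd_rel_def
proof (intro allI impI)
  fix D
  assume D: "dom_rel E V D" and min: "\<forall>d\<in>D. \<not> dom_rel E V (D - {d})"
  have S: "S \<subseteq> V" "inj_on l S" "l ` S = V - S" and l: "\<And>s. s \<in> S \<Longrightarrow> E `` {l s} = {s}"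
    using cor by (auto simp: corona_rel_def bij_betw_def)
  have leaf: "(x, l s) \<in> E \<longleftrightarrow> x = s" if "s \<in> S" for s x
    using l[OF that] \<open>sym E\<close> by (blast dest: symD)
  have lV: "l s \<in> V" "l s \<notin> S" if "s \<in> S" for s using S(3) that by blast+
  have DV: "D \<subseteq> V" using D by (simp add: dom_rel_def)
  define f where "f s = (if s \<in> D then s else l s)" for s
  \<comment> \<open>\<open>l s\<close> could be removed: it dominates only itself and
    \<open>s\<close>, and \<open>s\<close> takes care of both.\<close>
  have not_both: "l s \<notin> D" if s: "s \<in> S" "s \<in> D" for s
  proof
    assume "l s \<in> D"
    have ls: "s \<in> D - {l s}" "(s, l s) \<in> E"
      using s(2) lV(2)[OF s(1)] leaf[OF s(1)] s(1) by auto
    have "dom_rel E V (D - {l s})"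
      unfolding dom_rel_def
    proof (intro conjI ballI)
      fix v assume v: "v \<in> V"
      show "v \<in> D - {l s} \<or> (\<exists>u\<in>D - {l s}. (u, v) \<in> E)"
      proof (cases "v = l s \<or> v = s")
        case True
        then show ?thesis using ls by blast
      next
        case False
        then have "(l s, v) \<notin> E" using l[OF s(1)] by (metis ImageI singletonD singletonI)
        then show ?thesis using D v False unfolding dom_rel_def by blast
      qed
    qed (use DV in blast)
    then show False using min \<open>l s \<in> D\<close> by blast
  qed
  have "f ` S = D"
  proof
    have "l s \<in> D" if "s \<in> S" "s \<notin> D" for s
    proof -
      have "l s \<in> D \<or> (\<exists>u\<in>D. (u, l s) \<in> E)"
        using D lV(1)[OF that(1)] by (simp add: dom_rel_def)
      then show ?thesis using that(2) unfolding leaf[OF that(1)] by blast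
    qed
    then show "f ` S \<subseteq> D" by (auto simp: f_def)
    show "D \<subseteq> f ` S"
    proof
      fix d assume d: "d \<in> D"
      show "d \<in> f ` S"
      proof (cases "d \<in> S")
        case True
        then show ?thesis using d by (force simp: f_def)
      next
        case False
        then obtain s where "s \<in> S" "d = l s" using d DV S(3) by blast
        then show ?thesis using not_both d by (force simp: f_def)
      qed
    qed
  qed
  moreover have "inj_on f S"
    using S(2) lV(2) unfolding inj_on_def f_def by metis
  ultimately show "card D = card S" using card_image by metis
qed

text \<open>The leaf of \<open>(c, s)\<close> is the copy of \<open>l s\<close> in the opposite
  layer: a neighbour of that copy must lie in layer \<open>c\<close> over \<open>s\<close>, the only
  neighbour of \<open>l s\<close>.\<close>

lemma corona_rel_K2_prod:
  assumes cor: "corona_rel W F S l" and c: "c0 \<noteq> c1"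
  shows "\<exists>l'. corona_rel ({c0, c1} \<times> W) (prod_rel {(c0, c1), (c1, c0)} F) ({c0, c1} \<times> S) l'"
proof -
  have S: "S \<subseteq> W" "inj_on l S" "l ` S = W - S" and l: "\<And>s. s \<in> S \<Longrightarrow> F `` {l s} = {s}"
    using cor by (auto simp: corona_rel_def bij_betw_def)
  define l' where "l' = (\<lambda>(c, s). (if c = c0 then c1 else c0, l s))"
  have l': "l' (c0, s) = (c1, l s)" "l' (c1, s) = (c0, l s)" for s using c by (auto simp: l'_def)
  have "inj_on l' ({c0, c1} \<times> S)"
    using S(2) c by (auto simp: inj_on_def l'_def)
  moreover have "l' ` ({c0, c1} \<times> S) = {c0, c1} \<times> W - {c0, c1} \<times> S"
  proof -
    have "l' ` ({c0, c1} \<times> S) = {c0, c1} \<times> l ` S"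
    proof
      show "l' ` ({c0, c1} \<times> S) \<subseteq> {c0, c1} \<times> l ` S" using l' by auto
      show "{c0, c1} \<times> l ` S \<subseteq> l' ` ({c0, c1} \<times> S)"
      proof
        fix p assume "p \<in> {c0, c1} \<times> l ` S"
        then obtain s where s: "s \<in> S" "p = (c0, l s) \<or> p = (c1, l s)" by blast
        then have "p = l' (c1, s) \<or> p = l' (c0, s)" using l' by simp
        then show "p \<in> l' ` ({c0, c1} \<times> S)" using s(1) by blast
      qed
    qed
    then show ?thesis using S(3) by auto
  qed
  moreover have "prod_rel {(c0, c1), (c1, c0)} F `` {l' p} = {p}" if p: "p \<in> {c0, c1} \<times> S" for p
  proof -
    obtain c s where cs: "p = (c, s)" "c = c0 \<or> c = c1" "s \<in> S" using p by blast
    have "(l s, x) \<in> F \<longleftrightarrow> x = s" for x using l[OF cs(3)] by blast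
    then show ?thesis using cs c l' by auto
  qed
  ultimately show ?thesis using S(1) by (intro exI[of _ l']) (auto simp: corona_rel_def bij_betw_def)
qed

text \<open>Turns a cardinality into a sum over an explicit vertex set, so that the two small
  products below become arithmetic on membership.\<close>

lemma card_eq_sum_indicator:
  assumes "finite V" "D \<subseteq> V"
  shows "int (card D) = (\<Sum>v\<in>V. if v \<in> D then 1 else 0)"
  using assms by (simp add: sum.If_cases Int_absorb1)

text \<open>The vertex found is a private neighbour of \<open>d\<close>, possibly \<open>d\<close>
  itself. Quantifying over \<open>V\<close> instead of \<open>D\<close> lets the condition be
  expanded over an explicit vertex set.\<close>

lemma minimal_dom_private:
  assumes "dom_rel E V D" "\<not> dom_rel E V (D - {d})"
  shows "\<exists>v\<in>V. (v \<in> D \<longrightarrow> v = d) \<and> (\<forall>u\<in>V. u \<in> D \<longrightarrow> u \<noteq> d \<longrightarrow> (u, v) \<notin> E)"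
  using assms unfolding dom_rel_def by blast

text \<open>The product is the disjoint union of two 4-cycles, and a minimal dominating set has two
  vertices in each. The proof is a finite check on the eight vertices.\<close>

lemma wd_rel_K2_C4:
  assumes "distinct [c0, c1]" "distinct [a, b, c, d]"
  shows "wd_rel (prod_rel {(c0, c1), (c1, c0)}
      {(a, b), (b, a), (b, c), (c, b), (c, d), (d, c), (d, a), (a, d)}) ({c0, c1} \<times> {a, b, c, d}) 4"
  (is "wd_rel ?E ?V 4")
  unfolding wd_rel_def
proof (intro allI impI)
  fix D
  assume D: "dom_rel ?E ?V D" and min: "\<forall>p\<in>D. \<not> dom_rel ?E ?V (D - {p})"
  have V: "?V = {(c0, a), (c0, b), (c0, c), (c0, d), (c1, a), (c1, b), (c1, c), (c1, d)}" by auto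
  have dom: "\<forall>v\<in>?V. v \<in> D \<or> (\<exists>u\<in>?V. u \<in> D \<and> (u, v) \<in> ?E)"
    using D unfolding dom_rel_def by blast
  have priv: "\<forall>p\<in>?V. p \<in> D \<longrightarrow> (\<exists>v\<in>?V. (v \<in> D \<longrightarrow> v = p) \<and> (\<forall>u\<in>?V. u \<in> D \<longrightarrow> u \<noteq> p \<longrightarrow> (u, v) \<notin> ?E))"
    using minimal_dom_private[OF D] min by blast
  have "int (card D) = (\<Sum>v\<in>?V. if v \<in> D then 1 else 0)"
    using D by (intro card_eq_sum_indicator) (auto simp: dom_rel_def)
  also have "\<dots> = 4"
    using dom priv assms unfolding V
    by simp (smt (verit))
  finally show "card D = 4" by simp
qed

text \<open>A finite check: domination and private neighbours are expanded over the nine vertices,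
  and membership in \<open>D\<close> is decided.\<close>

lemma wd_rel_K3_K3:
  assumes "distinct [x, y, z]" "distinct [a, b, c]"
    and E: "E = {(x, y), (y, x), (y, z), (z, y), (x, z), (z, x)}"
    and F: "F = {(a, b), (b, a), (b, c), (c, b), (a, c), (c, a)}"
  shows "wd_rel (prod_rel E F) ({x, y, z} \<times> {a, b, c}) 3"
  (is "wd_rel ?E ?V 3")
  unfolding wd_rel_def
proof (intro allI impI)
  fix D
  assume D: "dom_rel ?E ?V D" and min: "\<forall>p\<in>D. \<not> dom_rel ?E ?V (D - {p})"
  have V: "?V = {(x, a), (x, b), (x, c), (y, a), (y, b), (y, c), (z, a), (z, b), (z, c)}" by auto
  have dom: "\<forall>v\<in>?V. v \<in> D \<or> (\<exists>u\<in>?V. u \<in> D \<and> (u, v) \<in> ?E)"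
    using D unfolding dom_rel_def by blast
  have priv: "\<forall>p\<in>?V. p \<in> D \<longrightarrow>
      (\<exists>v\<in>?V. (v \<in> D \<longrightarrow> v = p) \<and> (\<forall>u\<in>?V. u \<in> D \<longrightarrow> u \<noteq> p \<longrightarrow> (u, v) \<notin> ?E))"
    using minimal_dom_private[OF D] min by blast
  have "int (card D) = (\<Sum>v\<in>?V. if v \<in> D then 1 else 0)"
    using D by (intro card_eq_sum_indicator) (auto simp: dom_rel_def)
  also have "\<dots> = 3"
    using dom priv assms(1,2) unfolding V E F
    by simp (smt (verit))
  finally show "card D = 3" by simp
qed

lemma wd_rel_K2_prod:
  assumes G: "complete_digraph 2 (with_proj G)"
    and H: "pair_graph H" "connected_rel (pverts H) (parcs H)"
    and C4_or_corona:
      "digraph_iso (with_proj H) (with_proj (cycle_graph 4)) \<or> corona_of_connected_graph H"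
  shows "\<exists>k. wd_rel (prod_rel (parcs G) (parcs H)) (pverts G \<times> pverts H) k"
proof -
  interpret H: pair_graph H by fact
  interpret connected_rel "pverts H" "parcs H" by fact
  obtain c0 c1 where c: "c0 \<noteq> c1" "pverts G = {c0, c1}" "parcs G = {(c0, c1), (c1, c0)}"
    using complete_digraph_2E[OF G] by metis
  have "pair_wf_digraph H" ..
  then consider a b c d where "C4_rel (pverts H) (parcs H) a b c d"
    | S l where "corona_rel (pverts H) (parcs H) S l"
    using C4_or_corona C4_iff_iso_cycle_graph corona_of_connected_graph_iff[OF H] by metis
  then show ?thesis
  proof cases
    case (1 a b c d)
    then have C4: "distinct [a, b, c, d]" "pverts H = {a, b, c, d}"
      "parcs H = {(a, b), (b, a), (b, c), (c, b), (c, d), (d, c), (d, a), (a, d)}"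
      unfolding C4_rel_def by blast+
    have "distinct [c0, c1]" using c(1) by simp
    from wd_rel_K2_C4[OF this C4(1)] show ?thesis unfolding c C4(2,3) by blast
  next
    case (2 S l)
    then obtain l' where
      "corona_rel ({c0, c1} \<times> pverts H) (prod_rel {(c0, c1), (c1, c0)} (parcs H)) ({c0, c1} \<times> S) l'"
      using corona_rel_K2_prod c(1) by metis
    moreover have "sym (prod_rel {(c0, c1), (c1, c0)} (parcs H))"
      using sym_E by (intro sym_prod_rel) (auto simp: sym_def)
    ultimately show ?thesis unfolding c(2,3) using wd_rel_corona by blast
  qed
qed

lemma complete_digraph_3E:
  assumes "complete_digraph 3 (with_proj G)"
  obtains x y z where "distinct [x, y, z]" "pverts G = {x, y, z}"
    "parcs G = {(x, y), (y, x), (y, z), (z, y), (x, z), (z, x)}"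
proof -
  obtain x y z where c: "pverts G = {x, y, z}" "x \<noteq> y" "x \<noteq> z" "y \<noteq> z"
    using assms by (auto simp: complete_digraph_pair_def card_3_iff)
  then have "parcs G = {(x, y), (y, x), (y, z), (z, y), (x, z), (z, x)}"
    using assms by (auto simp: complete_digraph_pair_def)
  then show thesis using that c by simp
qed

lemma wd_rel_K3_prod:
  assumes "complete_digraph 3 (with_proj G)" "complete_digraph 3 (with_proj H)"
  shows "wd_rel (prod_rel (parcs G) (parcs H)) (pverts G \<times> pverts H) 3"
proof -
  obtain x y z where G: "distinct [x, y, z]" "pverts G = {x, y, z}"
    "parcs G = {(x, y), (y, x), (y, z), (z, y), (x, z), (z, x)}"
    using complete_digraph_3E[OF assms(1)] by metis
  obtain a b c where H: "distinct [a, b, c]" "pverts H = {a, b, c}"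
    "parcs H = {(a, b), (b, a), (b, c), (c, b), (a, c), (c, a)}"
    using complete_digraph_3E[OF assms(2)] by metis
  show ?thesis
    unfolding G(2) H(2) by (rule wd_rel_K3_K3[OF G(1) H(1) G(3) H(3)])
qed

lemma well_dominated_direct_product_if_wd_rel:
  assumes "wd_rel (prod_rel (parcs G) (parcs H)) (pverts G \<times> pverts H) k"
  shows "well_dominated (with_proj (direct_product G H))"
proof (rule well_dominatedI)
  fix D
  assume "dom_rel (parcs (direct_product G H)) (pverts (direct_product G H)) D"
    and "\<And>d. d \<in> D \<Longrightarrow> \<not> dom_rel (parcs (direct_product G H)) (pverts (direct_product G H)) (D - {d})"
  then show "card D = k"
    using assms unfolding wd_rel_def direct_product_simps by blast
qed

theorem theorem3:
  fixes G :: "'a pair_pre_digraph" and H :: "'b pair_pre_digraph"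
  assumes "pair_graph G" and "connected (with_proj G)" and "card (pverts G) \<ge> 2"
    and "pair_graph H" and "connected (with_proj H)" and "card (pverts H) \<ge> 2"
    and "(\<forall>x \<in> pverts G. \<not> isolatable (with_proj G) x) \<or>
         (\<forall>x \<in> pverts H. \<not> isolatable (with_proj H) x)"
  shows "well_dominated (with_proj (direct_product G H)) \<longleftrightarrow>
    (complete_digraph 3 (with_proj G) \<and> complete_digraph 3 (with_proj H)) \<or>
    (complete_digraph 2 (with_proj G) \<and>
      (digraph_iso (with_proj H) (with_proj (cycle_graph 4)) \<or> corona_of_connected_graph H)) \<or>
    (complete_digraph 2 (with_proj H) \<and>
      (digraph_iso (with_proj G) (with_proj (cycle_graph 4)) \<or> corona_of_connected_graph G))"
  (is "?lhs \<longleftrightarrow> ?rhs")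
proof
  have G: "connected_rel (pverts G) (parcs G)" and H: "connected_rel (pverts H) (parcs H)"
    using assms(1-6) by (blast intro: connected_relI)+
  interpret G: connected_rel "pverts G" "parcs G" by fact
  interpret H: connected_rel "pverts H" "parcs H" by fact
  {
    assume ?lhs
    then have tight: "tight_rel (prod_rel (parcs G) (parcs H)) (pverts G \<times> pverts H)"
      using tight_rel_if_well_dominated[of "direct_product G H"] G.finite_V H.finite_V
      by (simp add: direct_product_simps)
    from assms(7) show ?rhs
    proof
      assume "\<forall>x\<in>pverts G. \<not> isolatable (with_proj G) x"
      \<comment> \<open>The structure result wants the factor without isolatable vertices in second
        place, so the factors are exchanged.\<close>
      then show ?rhs
        using structure_if_tight[OF assms(4) H assms(1) G _ tight_rel_swap[OF tight]] by blast
    next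
      assume "\<forall>x\<in>pverts H. \<not> isolatable (with_proj H) x"
      then show ?rhs
        using structure_if_tight[OF assms(1) G assms(4) H _ tight] by blast
    qed
  next
    assume ?rhs
    then have "\<exists>k. wd_rel (prod_rel (parcs G) (parcs H)) (pverts G \<times> pverts H) k"
      using wd_rel_K3_prod[of G H] wd_rel_K2_prod[OF _ assms(4) H, of G]
        wd_rel_K2_prod[OF _ assms(1) G, of H] wd_rel_swap by metis
    then show ?lhs
      using well_dominated_direct_product_if_wd_rel by blast
  }
qed

end
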